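(* Let $\psi:N^2\to\mathbb{R}^3$, $(v,w)\mapsto(v,w,f(v,w))$, be a positive definite improper affine sphere with affine normal $(0,0,1)$. Define $\varphi(t,v,w)=(tv,\ tw,\ tf(v,w)-ct^4,\ t)$ or $\varphi(t,v,w)=(v,\ w,\ f(v,w)+ct^3,\ t^4)$, where $c,t\in\mathbb{R}^+$. Then (in either case) $\varphi$ defines a 3-dimensional indefinite improper affine hypersphere which admits a pointwise $\mathbb{Z}_3$- or $SO(2)$-symmetry.
   Context: $D$ is the flat connection and $\det$ the volume form of $\mathbb{R}^{n+1}$. For a nondegenerate immersed hypersurface $\varphi:M^n\to\mathbb{R}^{n+1}$ the affine (Blaschke) normal $\xi$ is the transverse vector field, unique up to sign, such that (identifying tangent vectors with their images under $\varphi_*$) $D_XY=\nabla_XY+h(X,Y)\xi$, $D_X\xi=-SX$ with $SX$ tangential, and the volume form $\det(\varphi_*X_1,\dots,\varphi_*X_n,\xi)$ equals (up to orientation) the volume form $|\det h|^{1/2}$ of $h$. $\nabla$ is the induced connection, $h$ the affine metric, $S$ the shape operator, $\widehat\nabla$ the Levi-Civita connection of $h$, and $K(X,Y)=\nabla_XY-\widehat\nabla_XY$ the difference tensor. $\varphi$ is an affine (hyper)sphere if $S=H\,\mathrm{Id}$ with $H$ constant; it is improper if $H=0$, positive definite / indefinite if $h$ is. For $n=3$ and $h$ indefinite, the sign of $\xi$ is fixed so that $h$ has exactly one negative direction. $M^3$ admits a pointwise $G$-symmetry if for every $p\in M$ there is a subgroup of the isometry group $SO(1,2)$ of $(T_pM,h)$,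 isomorphic to $G$, all of whose elements $L$ satisfy $K(LX_p,LY_p)=L(K(X_p,Y_p))$ for all $X_p,Y_p\in T_pM$. "Admits a pointwise $\mathbb{Z}_3$- or $SO(2)$-symmetry" means that at every point such a subgroup isomorphic to $\mathbb{Z}_3$ or to $SO(2)$ exists. *)

theory Defs
  imports "HOL-Analysis.Analysis" "HOL-Algebra.Elementary_Groups"
begin

section \<open>Smooth maps on open sets\<close>

text \<open>
  Manifolds are represented by open coordinate domains: \<open>U\<close> is an open subset of
  \<open>real^'n\<close>, every tangent space is \<open>real^'n\<close>, a vector field on \<open>U\<close> is a
  function \<open>real^'n \<Rightarrow> real^'n\<close> of which only the values on \<open>U\<close> matter.
\<close>

primrec C_k_on :: "nat \<Rightarrow> ('a::euclidean_space \<Rightarrow> 'b::real_normed_vector) \<Rightarrow> 'a set \<Rightarrow> bool" where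
  "C_k_on 0 f U \<longleftrightarrow> continuous_on U f"
| "C_k_on (Suc k) f U \<longleftrightarrow>
     (\<forall>p\<in>U. f differentiable (at p)) \<and>
     (\<forall>x. C_k_on k (\<lambda>p. frechet_derivative f (at p) x) U)"

definition smooth_on :: "'a::euclidean_space set \<Rightarrow> ('a \<Rightarrow> 'b::real_normed_vector) \<Rightarrow> bool" where
  "smooth_on U f \<longleftrightarrow> (\<forall>k. C_k_on k f U)"


section \<open>Bilinear forms\<close>

definition nondegenerate_form :: "('a::real_vector \<Rightarrow> 'a \<Rightarrow> real) \<Rightarrow> bool" where
  "nondegenerate_form B \<longleftrightarrow> (\<forall>x. (\<forall>y. B x y = 0) \<longrightarrow> x = 0)"

definition positive_definite_form :: "('a::real_vector \<Rightarrow> 'a \<Rightarrow> real) \<Rightarrow> bool" where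
  "positive_definite_form B \<longleftrightarrow> (\<forall>x. x \<noteq> 0 \<longrightarrow> B x x > 0)"

definition indefinite_form :: "('a::real_vector \<Rightarrow> 'a \<Rightarrow> real) \<Rightarrow> bool" where
  "indefinite_form B \<longleftrightarrow> (\<exists>x. B x x < 0) \<and> (\<exists>y. B y y > 0)"

text \<open>The number of negative directions of \<open>B\<close>.\<close>

definition negative_index :: "('a::euclidean_space \<Rightarrow> 'a \<Rightarrow> real) \<Rightarrow> nat" where
  "negative_index B = Max {dim V | V. subspace V \<and> (\<forall>x\<in>V. x \<noteq> 0 \<longrightarrow> B x x < 0)}"


section \<open>Connections and the Levi-Civita connection\<close>

text \<open>\<open>nabla X Y p\<close> is the value of \<open>\<nabla>\<^sub>X Y\<close> at \<open>p\<close>.\<close>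

definition affine_connection_on ::
  "'a::euclidean_space set \<Rightarrow> (('a \<Rightarrow> 'a) \<Rightarrow> ('a \<Rightarrow> 'a) \<Rightarrow> 'a \<Rightarrow> 'a) \<Rightarrow> bool" where
  "affine_connection_on U nabla \<longleftrightarrow>
     (\<forall>X Y. smooth_on U X \<longrightarrow> smooth_on U Y \<longrightarrow> smooth_on U (nabla X Y)) \<and>
     (\<forall>X X' Y. smooth_on U X \<longrightarrow> smooth_on U X' \<longrightarrow> smooth_on U Y \<longrightarrow>
        (\<forall>p\<in>U. nabla (\<lambda>q. X q + X' q) Y p = nabla X Y p + nabla X' Y p)) \<and>
     (\<forall>X Y Y'. smooth_on U X \<longrightarrow> smooth_on U Y \<longrightarrow> smooth_on U Y' \<longrightarrow>
        (\<forall>p\<in>U. nabla X (\<lambda>q. Y q + Y' q) p = nabla X Y p + nabla X Y' p)) \<and>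
     (\<forall>g X Y. smooth_on U (g :: 'a \<Rightarrow> real) \<longrightarrow> smooth_on U X \<longrightarrow> smooth_on U Y \<longrightarrow>
        (\<forall>p\<in>U. nabla (\<lambda>q. g q *\<^sub>R X q) Y p = g p *\<^sub>R nabla X Y p \<and>
               nabla X (\<lambda>q. g q *\<^sub>R Y q) p =
                 frechet_derivative g (at p) (X p) *\<^sub>R Y p + g p *\<^sub>R nabla X Y p))"

definition lie_bracket :: "('a::euclidean_space \<Rightarrow> 'a) \<Rightarrow> ('a \<Rightarrow> 'a) \<Rightarrow> 'a \<Rightarrow> 'a" where
  "lie_bracket X Y p =
     frechet_derivative Y (at p) (X p) - frechet_derivative X (at p) (Y p)"

definition levi_civita_on ::
  "'a::euclidean_space set \<Rightarrow> ('a \<Rightarrow> 'a \<Rightarrow> 'a \<Rightarrow> real) \<Rightarrow>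
   (('a \<Rightarrow> 'a) \<Rightarrow> ('a \<Rightarrow> 'a) \<Rightarrow> 'a \<Rightarrow> 'a) \<Rightarrow> bool" where
  "levi_civita_on U g nabla \<longleftrightarrow>
     affine_connection_on U nabla \<and>
     (\<forall>X Y. smooth_on U X \<longrightarrow> smooth_on U Y \<longrightarrow>
        (\<forall>p\<in>U. nabla X Y p - nabla Y X p = lie_bracket X Y p)) \<and>
     (\<forall>X Y Z. smooth_on U X \<longrightarrow> smooth_on U Y \<longrightarrow> smooth_on U Z \<longrightarrow>
        (\<forall>p\<in>U. frechet_derivative (\<lambda>q. g q (Y q) (Z q)) (at p) (X p) =
               g p (nabla X Y p) (Z p) + g p (Y p) (nabla X Z p)))"

text \<open>
  For a smooth nondegenerate metric \<open>g\<close> on an open set, the values of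
  \<open>levi_civita U g\<close> on smooth fields at points of \<open>U\<close> do not depend on the choice
  made here, by the Koszul formula.
\<close>

definition levi_civita ::
  "'a::euclidean_space set \<Rightarrow> ('a \<Rightarrow> 'a \<Rightarrow> 'a \<Rightarrow> real) \<Rightarrow>
   ('a \<Rightarrow> 'a) \<Rightarrow> ('a \<Rightarrow> 'a) \<Rightarrow> 'a \<Rightarrow> 'a" where
  "levi_civita U g = (SOME nabla. levi_civita_on U g nabla)"


section \<open>Affine hypersurfaces\<close>

text \<open>
  \<open>\<phi> :: real^'n \<Rightarrow> real^'m\<close> with \<open>CARD('m) = CARD('n) + 1\<close> is considered on the open
  set \<open>U\<close>, and \<open>\<xi>\<close> is a vector field along \<open>\<phi>\<close>.
\<close>

definition immersion_on :: "(real^'n) set \<Rightarrow> (real^'n \<Rightarrow> real^'m) \<Rightarrow> bool" where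
  "immersion_on U \<phi> \<longleftrightarrow>
     open U \<and> smooth_on U \<phi> \<and> (\<forall>p\<in>U. inj (frechet_derivative \<phi> (at p)))"

definition transversal_on ::
  "(real^'n) set \<Rightarrow> (real^'n \<Rightarrow> real^'m) \<Rightarrow> (real^'n \<Rightarrow> real^'m) \<Rightarrow> bool" where
  "transversal_on U \<phi> \<xi> \<longleftrightarrow>
     smooth_on U \<xi> \<and> (\<forall>p\<in>U. \<xi> p \<notin> range (frechet_derivative \<phi> (at p)))"

text \<open>
  Components of an ambient vector \<open>Z\<close> at \<open>p\<close> in the decomposition
  \<open>Z = \<phi>\<^sub>* u + a \<xi>\<close>.
\<close>

definition tangential_part ::
  "(real^'n \<Rightarrow> real^'m) \<Rightarrow> (real^'n \<Rightarrow> real^'m) \<Rightarrow> real^'n \<Rightarrow> real^'m \<Rightarrow> real^'n" where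
  "tangential_part \<phi> \<xi> p Z =
     (THE u. \<exists>a. Z = frechet_derivative \<phi> (at p) u + a *\<^sub>R \<xi> p)"

definition transversal_part ::
  "(real^'n \<Rightarrow> real^'m) \<Rightarrow> (real^'n \<Rightarrow> real^'m) \<Rightarrow> real^'n \<Rightarrow> real^'m \<Rightarrow> real" where
  "transversal_part \<phi> \<xi> p Z =
     (THE a. \<exists>u. Z = frechet_derivative \<phi> (at p) u + a *\<^sub>R \<xi> p)"

text \<open>\<open>flat_derivative \<phi> X Y p\<close> is \<open>D\<^sub>X (\<phi>\<^sub>* Y)\<close> at \<open>p\<close>.\<close>

definition flat_derivative ::
  "(real^'n \<Rightarrow> real^'m) \<Rightarrow> (real^'n \<Rightarrow> real^'n) \<Rightarrow> (real^'n \<Rightarrow> real^'n) \<Rightarrow>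
   real^'n \<Rightarrow> real^'m" where
  "flat_derivative \<phi> X Y p =
     frechet_derivative (\<lambda>q. frechet_derivative \<phi> (at q) (Y q)) (at p) (X p)"

definition induced_connection ::
  "(real^'n \<Rightarrow> real^'m) \<Rightarrow> (real^'n \<Rightarrow> real^'m) \<Rightarrow>
   (real^'n \<Rightarrow> real^'n) \<Rightarrow> (real^'n \<Rightarrow> real^'n) \<Rightarrow> real^'n \<Rightarrow> real^'n" where
  "induced_connection \<phi> \<xi> X Y p = tangential_part \<phi> \<xi> p (flat_derivative \<phi> X Y p)"

text \<open>
  The transversal part of \<open>D\<^sub>X (\<phi>\<^sub>* Y)\<close> at \<open>p\<close> depends only on the values
  \<open>x\<close>, \<open>y\<close> of \<open>X\<close>, \<open>Y\<close> at \<open>p\<close>; here it is evaluated on the constant extensions.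
  The same applies to the difference tensor below.
\<close>

definition affine_metric ::
  "(real^'n \<Rightarrow> real^'m) \<Rightarrow> (real^'n \<Rightarrow> real^'m) \<Rightarrow> real^'n \<Rightarrow> real^'n \<Rightarrow> real^'n \<Rightarrow> real" where
  "affine_metric \<phi> \<xi> p x y =
     transversal_part \<phi> \<xi> p (flat_derivative \<phi> (\<lambda>_. x) (\<lambda>_. y) p)"

definition shape_operator ::
  "(real^'n \<Rightarrow> real^'m) \<Rightarrow> (real^'n \<Rightarrow> real^'m) \<Rightarrow> real^'n \<Rightarrow> real^'n \<Rightarrow> real^'n" where
  "shape_operator \<phi> \<xi> p x = - tangential_part \<phi> \<xi> p (frechet_derivative \<xi> (at p) x)"

text \<open>
  The indices produced by \<open>vector\<close> are \<open>1, 1 + 1, \<dots>\<close>, so from here on the index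
  types are meant to be numeral types.
\<close>

definition det_rows :: "(real^'n::{finite,one,plus}) list \<Rightarrow> real" where
  "det_rows rs = det (vector rs :: real^'n::{finite,one,plus}^'n::{finite,one,plus})"

text \<open>
  \<open>\<xi>\<close> is an affine (Blaschke) normal of the nondegenerate immersion \<open>\<phi>\<close>. The last
  condition compares, up to orientation, \<open>det (\<phi>\<^sub>* X\<^sub>1, \<dots>, \<phi>\<^sub>* X\<^sub>n, \<xi>)\<close>
  with the volume form of \<open>h\<close>, which is the square root of
  \<open>\<bar>det (h (X\<^sub>i, X\<^sub>j))\<bar>\<close>, on arbitrary tangent vectors \<open>X\<^sub>1, \<dots>, X\<^sub>n\<close>.
\<close>

definition affine_normal_on ::
  "(real^'n::{finite,one,plus}) set \<Rightarrow>
   (real^'n::{finite,one,plus} \<Rightarrow> real^'m::{finite,one,plus}) \<Rightarrow>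
   (real^'n::{finite,one,plus} \<Rightarrow> real^'m::{finite,one,plus}) \<Rightarrow> bool" where
  "affine_normal_on U \<phi> \<xi> \<longleftrightarrow>
     CARD('m) = CARD('n) + 1 \<and>
     immersion_on U \<phi> \<and>
     transversal_on U \<phi> \<xi> \<and>
     (\<forall>p\<in>U.
        nondegenerate_form (affine_metric \<phi> \<xi> p) \<and>
        range (frechet_derivative \<xi> (at p)) \<subseteq> range (frechet_derivative \<phi> (at p)) \<and>
        (\<forall>Xs. length Xs = CARD('n) \<longrightarrow>
           \<bar>det_rows (map (frechet_derivative \<phi> (at p)) Xs @ [\<xi> p])\<bar> =
           sqrt \<bar>det_rows (map (\<lambda>x. vector (map (affine_metric \<phi> \<xi> p x) Xs)
                                :: real^'n::{finite,one,plus}) Xs)\<bar>))"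

definition affine_sphere_on ::
  "(real^'n::{finite,one,plus}) set \<Rightarrow>
   (real^'n::{finite,one,plus} \<Rightarrow> real^'m::{finite,one,plus}) \<Rightarrow>
   (real^'n::{finite,one,plus} \<Rightarrow> real^'m::{finite,one,plus}) \<Rightarrow> real \<Rightarrow> bool" where
  "affine_sphere_on U \<phi> \<xi> H \<longleftrightarrow>
     affine_normal_on U \<phi> \<xi> \<and> (\<forall>p\<in>U. \<forall>x. shape_operator \<phi> \<xi> p x = H *\<^sub>R x)"

definition improper_affine_sphere_on ::
  "(real^'n::{finite,one,plus}) set \<Rightarrow>
   (real^'n::{finite,one,plus} \<Rightarrow> real^'m::{finite,one,plus}) \<Rightarrow>
   (real^'n::{finite,one,plus} \<Rightarrow> real^'m::{finite,one,plus}) \<Rightarrow> bool" where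
  "improper_affine_sphere_on U \<phi> \<xi> \<longleftrightarrow> affine_sphere_on U \<phi> \<xi> 0"

definition difference_tensor ::
  "(real^'n) set \<Rightarrow> (real^'n \<Rightarrow> real^'m) \<Rightarrow> (real^'n \<Rightarrow> real^'m) \<Rightarrow>
   real^'n \<Rightarrow> real^'n \<Rightarrow> real^'n \<Rightarrow> real^'n" where
  "difference_tensor U \<phi> \<xi> p x y =
     induced_connection \<phi> \<xi> (\<lambda>_. x) (\<lambda>_. y) p
     - levi_civita U (affine_metric \<phi> \<xi>) (\<lambda>_. x) (\<lambda>_. y) p"


section \<open>Pointwise symmetry\<close>

text \<open>Linear maps of a tangent space are given by their matrices, acting by \<open>*v\<close>.\<close>

definition special_isometry_group :: "(real^'n \<Rightarrow> real^'n \<Rightarrow> real) \<Rightarrow> (real^'n^'n) monoid" where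
  "special_isometry_group B =
     \<lparr>carrier = {A. (\<forall>x y. B (A *v x) (A *v y) = B x y) \<and> det A = 1},
      mult = (\<lambda>A A'. A ** A'), one = mat 1\<rparr>"

definition SO2 :: "(real^2^2) monoid" where
  "SO2 = special_isometry_group (\<bullet>)"

text \<open>Isomorphism of topological groups; on closed matrix groups this is isomorphism of Lie groups.\<close>

definition topologically_isomorphic ::
  "('a::topological_space) monoid \<Rightarrow> ('b::topological_space) monoid \<Rightarrow> bool" where
  "topologically_isomorphic G H \<longleftrightarrow>
     (\<exists>f g. f \<in> iso G H \<and> homeomorphism (carrier G) (carrier H) f g)"

definition symmetry_subgroup_at ::
  "(real^'n) set \<Rightarrow> (real^'n \<Rightarrow> real^'m) \<Rightarrow> (real^'n \<Rightarrow> real^'m) \<Rightarrow> real^'n \<Rightarrow>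
   (real^'n^'n) set \<Rightarrow> bool" where
  "symmetry_subgroup_at U \<phi> \<xi> p \<Gamma> \<longleftrightarrow>
     subgroup \<Gamma> (special_isometry_group (affine_metric \<phi> \<xi> p)) \<and>
     (\<forall>L\<in>\<Gamma>. \<forall>x y.
        difference_tensor U \<phi> \<xi> p (L *v x) (L *v y) = L *v difference_tensor U \<phi> \<xi> p x y)"

definition admits_pointwise_Z3_or_SO2_symmetry ::
  "(real^'n) set \<Rightarrow> (real^'n \<Rightarrow> real^'m) \<Rightarrow> (real^'n \<Rightarrow> real^'m) \<Rightarrow> bool" where
  "admits_pointwise_Z3_or_SO2_symmetry U \<phi> \<xi> \<longleftrightarrow>
     (\<forall>p\<in>U. \<exists>\<Gamma>. symmetry_subgroup_at U \<phi> \<xi> p \<Gamma> \<and>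
        (let G = (special_isometry_group (affine_metric \<phi> \<xi> p))\<lparr>carrier := \<Gamma>\<rparr>
         in G \<cong> integer_mod_group 3 \<or> topologically_isomorphic G SO2))"

end

theory Submission
  imports Defs
begin

text \<open>
  The hypothesis on \<open>\<psi>\<close> says that the Hessian of \<open>f\<close> is positive definite of determinant 1. In both
  cases \<open>\<phi>\<close> has a constant transversal field, \<open>(0, 0, \<kappa>, 0)\<close> with \<open>\<kappa>\<^sup>5 = 12 c\<close> for the first and
  \<open>(0, 0, 0, -r\<^sup>2)\<close> with \<open>9 c\<^sup>2 r\<^sup>5 = 8\<close> for the second, whose affine metric is the warped product
  \<open>-A t\<^sup>2 dt\<^sup>2 + B t Hess f\<close>; the value of \<open>\<kappa>\<close> or \<open>r\<close> is what the volume condition demands.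
  The induced connection and the Christoffel symbols of the metric are explicit, and their difference
  \<open>K\<close> is a rotationally symmetric tensor minus one half of the cubic form of \<open>f\<close>. Differentiating
  \<open>det Hess f = 1\<close> shows that this cubic form is traceless with respect to \<open>Hess f\<close>, that is, the real
  part of a complex cubic \<open>z\<^sup>3\<close>. Hence the rotations of the \<open>(v,w)\<close>-plane by multiples of \<open>2\<pi>/3\<close>,
  with respect to \<open>Hess f\<close>, preserve \<open>K\<close>, and there is always a \<open>\<int>\<^sub>3\<close>-symmetry.
\<close>

section \<open>Calculus of smooth maps\<close>

lemma frechet_derivative_eqI:
  "(f has_derivative f') (at p) \<Longrightarrow> frechet_derivative f (at p) = f'"
  by (rule frechet_derivative_at[symmetric])

text \<open>Derivatives at \<open>p\<close> see a whole neighbourhood of \<open>p\<close>; since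
  \<open>U\<close> is open, agreement on \<open>U\<close> passes to all derivatives, one order at a
  time.\<close>

lemma C_k_on_cong:
  assumes "open U" "\<And>p. p \<in> U \<Longrightarrow> f p = g p"
  shows "C_k_on k f U \<longleftrightarrow> C_k_on k g U"
  using assms(2)
proof (induction k arbitrary: f g)
  case 0
  then show ?case by (simp cong: continuous_on_cong)
next
  case (Suc k)
  have *: "C_k_on (Suc k) f U \<Longrightarrow> C_k_on (Suc k) g U"
    if eq: "\<And>p. p \<in> U \<Longrightarrow> f p = g p" for f g :: "'a \<Rightarrow> 'b"
  proof -
    assume f: "C_k_on (Suc k) f U"
    have d: "(g has_derivative frechet_derivative f (at p)) (at p)" if "p \<in> U" for p
    proof (rule has_derivative_transform_within_open[OF _ assms(1) that eq])
      show "(f has_derivative frechet_derivative f (at p)) (at p)"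
        using f that by (simp add: frechet_derivative_works[symmetric])
    qed
    then have "C_k_on k (\<lambda>p. frechet_derivative g (at p) x) U" for x
      using Suc.IH[of "\<lambda>p. frechet_derivative f (at p) x" "\<lambda>p. frechet_derivative g (at p) x"] f
      by (simp add: frechet_derivative_eqI[OF d])
    then show ?thesis using d by (auto simp: differentiable_def)
  qed
  show ?case using *[of f g] *[of g f] Suc.prems by metis
qed

text \<open>Allows an explicit candidate \<open>f'\<close> for the derivative, which uniqueness
  identifies with the \<open>frechet_derivative\<close> of the definition.\<close>

lemma C_k_on_SucI:
  assumes "open U" "\<And>p. p \<in> U \<Longrightarrow> (f has_derivative f' p) (at p)"
    "\<And>x. C_k_on k (\<lambda>p. f' p x) U"
  shows "C_k_on (Suc k) f U"
proof -
  have "C_k_on k (\<lambda>p. frechet_derivative f (at p) x) U" for x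
    using C_k_on_cong[OF assms(1), of "\<lambda>p. frechet_derivative f (at p) x" "\<lambda>p. f' p x"] assms(3)
    by (simp add: frechet_derivative_eqI[OF assms(2)])
  then show ?thesis using assms(2) by (auto simp: differentiable_def)
qed

lemma C_k_on_SucD: "C_k_on (Suc k) f U \<Longrightarrow> C_k_on k f U"
proof (induction k arbitrary: f)
  case 0
  then show ?case
    by (auto intro!: continuous_at_imp_continuous_on differentiable_imp_continuous_within)
next
  case (Suc k)
  then show ?case by (metis C_k_on.simps(2))
qed

lemma C_k_on_Suc_has_derivative:
  "C_k_on (Suc k) f U \<Longrightarrow> p \<in> U \<Longrightarrow> (f has_derivative frechet_derivative f (at p)) (at p)"
  by (simp add: frechet_derivative_works[symmetric])

lemma C_k_on_const: "open U \<Longrightarrow> C_k_on k (\<lambda>_. c) U"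
  by (induction k arbitrary: c) auto

lemma C_k_on_bounded_linear:
  assumes "open U" "bounded_linear f"
  shows "C_k_on k f U"
proof (cases k)
  case 0
  then show ?thesis using assms by (simp add: linear_continuous_on)
next
  case (Suc n)
  then show ?thesis
    using C_k_on_SucI[OF assms(1), of f "\<lambda>_. f"] bounded_linear_imp_has_derivative[OF assms(2)]
      C_k_on_const[OF assms(1)] by blast
qed

lemma C_k_on_add:
  assumes "open U" "C_k_on k f U" "C_k_on k g U"
  shows "C_k_on k (\<lambda>p. f p + g p) U"
  using assms(2,3)
proof (induction k arbitrary: f g)
  case 0
  then show ?case by (simp add: continuous_on_add)
next
  case (Suc k)
  show ?case
  proof (rule C_k_on_SucI[OF assms(1)])
    show "((\<lambda>p. f p + g p) has_derivative
        (\<lambda>x. frechet_derivative f (at p) x + frechet_derivative g (at p) x)) (at p)" if "p \<in> U" for p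
      using Suc.prems that by (intro has_derivative_add C_k_on_Suc_has_derivative)
    show "C_k_on k (\<lambda>p. frechet_derivative f (at p) x + frechet_derivative g (at p) x) U" for x
      using Suc.prems by (intro Suc.IH) auto
  qed
qed

text \<open>One induction for real products and scalar multiples alike. Each summand of the product
  rule keeps one undifferentiated factor, which is lowered from order \<open>Suc k\<close> to
  \<open>k\<close> by \<open>C_k_on_SucD\<close>.\<close>

lemma (in bounded_bilinear) C_k_on_prod:
  fixes f :: "'d::euclidean_space \<Rightarrow> 'a" and g :: "'d \<Rightarrow> 'b"
  assumes "open U" "C_k_on k f U" "C_k_on k g U"
  shows "C_k_on k (\<lambda>p. prod (f p) (g p)) U"
  using assms(2,3)
proof (induction k arbitrary: f g)
  case 0
  then show ?case by (simp add: continuous_on)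
next
  case (Suc k)
  show ?case
  proof (rule C_k_on_SucI[OF assms(1)])
    show "((\<lambda>p. prod (f p) (g p)) has_derivative
        (\<lambda>x. prod (f p) (frechet_derivative g (at p) x) + prod (frechet_derivative f (at p) x) (g p))) (at p)"
      if "p \<in> U" for p
      using Suc.prems that by (intro FDERIV C_k_on_Suc_has_derivative)
    show "C_k_on k (\<lambda>p. prod (f p) (frechet_derivative g (at p) x)
        + prod (frechet_derivative f (at p) x) (g p)) U" for x
      using Suc.prems Suc.prems[THEN C_k_on_SucD] assms(1)
      by (intro C_k_on_add Suc.IH) auto
  qed
qed

text \<open>For a linear inner map the chain rule evaluates the derivative of \<open>f\<close> in
  the fixed direction \<open>L x\<close>, so the derivative is again a composition with
  \<open>L\<close> and the induction closes.\<close>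

lemma C_k_on_compose_linear:
  assumes "open U" "bounded_linear L" "\<And>p. p \<in> U \<Longrightarrow> L p \<in> N" "C_k_on k f N"
  shows "C_k_on k (\<lambda>p. f (L p)) U"
  using assms(4)
proof (induction k arbitrary: f)
  case 0
  then show ?case
    using assms(2,3) continuous_on_compose2[of N f U L] by (auto intro: linear_continuous_on)
next
  case (Suc k)
  show ?case
  proof (rule C_k_on_SucI[OF assms(1)])
    show "((\<lambda>p. f (L p)) has_derivative (\<lambda>x. frechet_derivative f (at (L p)) (L x))) (at p)"
      if "p \<in> U" for p
      using has_derivative_compose[OF bounded_linear_imp_has_derivative[OF assms(2)]
          C_k_on_Suc_has_derivative[OF Suc.prems assms(3)[OF that]]] .
    show "C_k_on k (\<lambda>p. frechet_derivative f (at (L p)) (L x)) U" for x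
      using Suc.prems by (intro Suc.IH[of "\<lambda>q. frechet_derivative f (at q) (L x)"]) auto
  qed
qed

text \<open>The derivative of \<open>1 / f\<close> is a product of \<open>1 / f\<close> and
  derivatives of \<open>f\<close>, so order \<open>k\<close> for the inverse yields order
  \<open>Suc k\<close>.\<close>

lemma C_k_on_inverse:
  fixes f :: "'a::euclidean_space \<Rightarrow> real"
  assumes "open U" "\<And>p. p \<in> U \<Longrightarrow> f p \<noteq> 0" "C_k_on k f U"
  shows "C_k_on k (\<lambda>p. inverse (f p)) U"
  using assms(3)
proof (induction k)
  case 0
  then show ?case using assms(2) by (auto intro: continuous_on_inverse)
next
  case (Suc k)
  show ?case
  proof (rule C_k_on_SucI[OF assms(1)])
    show "((\<lambda>p. inverse (f p)) has_derivative
        (\<lambda>x. (-1) * (inverse (f p) * (frechet_derivative f (at p) x * inverse (f p))))) (at p)"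
      if "p \<in> U" for p
      using Suc.prems that assms(2)
      by (auto intro!: derivative_eq_intros C_k_on_Suc_has_derivative)
    show "C_k_on k (\<lambda>p. (-1) * (inverse (f p) * (frechet_derivative f (at p) x * inverse (f p)))) U" for x
      using Suc.prems Suc.IH[OF C_k_on_SucD[OF Suc.prems]] assms(1)
      by (intro bounded_bilinear.C_k_on_prod[OF bounded_bilinear_mult] C_k_on_const) auto
  qed
qed

section \<open>Closure properties of smooth maps\<close>

named_theorems smooth_intros

lemma smooth_on_cong:
  assumes "open U" "\<And>p. p \<in> U \<Longrightarrow> f p = g p"
  shows "smooth_on U f \<longleftrightarrow> smooth_on U g"
  using C_k_on_cong[OF assms] by (simp add: smooth_on_def)

lemma smooth_on_has_derivative:
  "smooth_on U f \<Longrightarrow> p \<in> U \<Longrightarrow> (f has_derivative frechet_derivative f (at p)) (at p)"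
  by (rule C_k_on_Suc_has_derivative[of 0]) (simp_all add: smooth_on_def del: C_k_on.simps)

lemma smooth_on_frechet_derivative: "smooth_on U f \<Longrightarrow> smooth_on U (\<lambda>p. frechet_derivative f (at p) x)"
  unfolding smooth_on_def by (metis C_k_on.simps(2))

lemma smooth_on_const [smooth_intros]: "open U \<Longrightarrow> smooth_on U (\<lambda>_. c)"
  by (simp add: smooth_on_def C_k_on_const)

lemma smooth_on_bounded_linear: "open U \<Longrightarrow> bounded_linear f \<Longrightarrow> smooth_on U f"
  by (simp add: smooth_on_def C_k_on_bounded_linear)

lemma smooth_on_coordinate [smooth_intros]: "open U \<Longrightarrow> smooth_on U (\<lambda>p. p $ i)"
  by (simp add: smooth_on_bounded_linear bounded_linear_vec_nth)

lemma smooth_on_add [smooth_intros]: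
  "open U \<Longrightarrow> smooth_on U f \<Longrightarrow> smooth_on U g \<Longrightarrow> smooth_on U (\<lambda>p. f p + g p)"
  by (simp add: smooth_on_def C_k_on_add)

lemma smooth_on_scaleR [smooth_intros]:
  "open U \<Longrightarrow> smooth_on U f \<Longrightarrow> smooth_on U g \<Longrightarrow> smooth_on U (\<lambda>p. f p *\<^sub>R g p)"
  by (simp add: smooth_on_def bounded_bilinear.C_k_on_prod[OF bounded_bilinear_scaleR])

lemma smooth_on_mult [smooth_intros]:
  fixes f g :: "_ \<Rightarrow> real"
  shows "open U \<Longrightarrow> smooth_on U f \<Longrightarrow> smooth_on U g \<Longrightarrow> smooth_on U (\<lambda>p. f p * g p)"
  by (simp add: smooth_on_def bounded_bilinear.C_k_on_prod[OF bounded_bilinear_mult])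

lemma smooth_on_minus [smooth_intros]:
  assumes "open U" "smooth_on U f"
  shows "smooth_on U (\<lambda>p. - f p)"
  using smooth_on_scaleR[OF assms(1) smooth_on_const[OF assms(1), of "-1"] assms(2)] by simp

lemma smooth_on_diff [smooth_intros]:
  assumes "open U" "smooth_on U f" "smooth_on U g"
  shows "smooth_on U (\<lambda>p. f p - g p)"
  using smooth_on_add[OF assms(1,2) smooth_on_minus[OF assms(1,3)]] by simp

lemma smooth_on_power [smooth_intros]:
  fixes f :: "_ \<Rightarrow> real"
  shows "open U \<Longrightarrow> smooth_on U f \<Longrightarrow> smooth_on U (\<lambda>p. f p ^ n)"
  by (induction n) (simp_all add: smooth_on_const smooth_on_mult)

lemma smooth_on_divide [smooth_intros]:
  fixes f g :: "_ \<Rightarrow> real"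
  assumes "open U" "\<And>p. p \<in> U \<Longrightarrow> g p \<noteq> 0" "smooth_on U f" "smooth_on U g"
  shows "smooth_on U (\<lambda>p. f p / g p)"
  using assms C_k_on_inverse[OF assms(1,2)] smooth_on_mult[OF assms(1,3)]
  by (simp add: smooth_on_def divide_inverse)

lemma smooth_on_sum [smooth_intros]:
  "open U \<Longrightarrow> (\<And>i. i \<in> I \<Longrightarrow> smooth_on U (f i)) \<Longrightarrow> smooth_on U (\<lambda>p. \<Sum>i\<in>I. f i p)"
  by (induction I rule: infinite_finite_induct) (simp_all add: smooth_on_const smooth_on_add)

lemma smooth_on_compose_linear:
  "open U \<Longrightarrow> bounded_linear L \<Longrightarrow> (\<And>p. p \<in> U \<Longrightarrow> L p \<in> N) \<Longrightarrow> smooth_on N f \<Longrightarrow>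
    smooth_on U (\<lambda>p. f (L p))"
  unfolding smooth_on_def by (intro allI C_k_on_compose_linear[of U L N]) auto

lemma smooth_on_component [smooth_intros]:
  fixes f :: "'a::euclidean_space \<Rightarrow> real^'b"
  assumes "open U" "smooth_on U f"
  shows "smooth_on U (\<lambda>p. f p $ i)"
proof -
  have "C_k_on k (\<lambda>p. f p $ i) U" if "C_k_on k f U" for k and f :: "'a \<Rightarrow> real^'b"
    using that
  proof (induction k arbitrary: f)
    case 0
    then show ?case by (simp add: continuous_on_component)
  next
    case (Suc k)
    show ?case
    proof (rule C_k_on_SucI[OF assms(1)])
      show "((\<lambda>p. f p $ i) has_derivative (\<lambda>x. frechet_derivative f (at p) x $ i)) (at p)"
        if "p \<in> U" for p
        using bounded_linear.has_derivative[OF bounded_linear_vec_nth]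
          C_k_on_Suc_has_derivative[OF Suc.prems that] .
      show "C_k_on k (\<lambda>p. frechet_derivative f (at p) x $ i) U" for x
        using Suc.prems by (intro Suc.IH) auto
    qed
  qed
  then show ?thesis using assms(2) by (simp add: smooth_on_def)
qed

lemma smooth_on_componentwise:
  fixes f :: "'a::euclidean_space \<Rightarrow> real^'n"
  assumes "open U" "\<And>i. smooth_on U (\<lambda>p. f p $ i)"
  shows "smooth_on U f"
proof -
  have "smooth_on U (\<lambda>p. \<Sum>i\<in>UNIV. f p $ i *\<^sub>R axis i (1::real))"
    using assms by (intro smooth_on_sum smooth_on_scaleR smooth_on_const)
  moreover have "(\<Sum>i\<in>UNIV. f p $ i *\<^sub>R axis i (1::real)) = f p" for p
    using basis_expansion[of "f p"] by (simp add: scalar_mult_eq_scaleR)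
  ultimately show ?thesis by simp
qed

section \<open>Componentwise derivatives, determinants in dimension four, and second
  derivatives\<close>

lemma vector_4 [simp]:
  "(vector [x,y,z,w] :: ('a::zero)^4) $ 1 = x"
  "(vector [x,y,z,w] :: ('a::zero)^4) $ 2 = y"
  "(vector [x,y,z,w] :: ('a::zero)^4) $ 3 = z"
  "(vector [x,y,z,w] :: ('a::zero)^4) $ 4 = w"
  unfolding vector_def by simp_all

lemma has_derivative_vec_componentwise:
  fixes f :: "'a::real_normed_vector \<Rightarrow> real^'n"
  assumes "\<And>i. ((\<lambda>q. f q $ i) has_derivative (\<lambda>h. f' h $ i)) F"
  shows "(f has_derivative f') F"
proof -
  have eq: "(\<Sum>i\<in>UNIV. x $ i *\<^sub>R axis i 1) = x" for x :: "real^'n"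
    using basis_expansion[of x] by (simp add: scalar_mult_eq_scaleR)
  have "((\<lambda>q. \<Sum>i\<in>UNIV. f q $ i *\<^sub>R axis i (1::real)) has_derivative
      (\<lambda>h. \<Sum>i\<in>UNIV. f' h $ i *\<^sub>R axis i 1)) F"
    using assms by (intro has_derivative_sum has_derivative_scaleR_left)
  then show ?thesis unfolding eq .
qed

text \<open>Expansion along the last row, where the transversal vector will stand; it has a single
  nonzero entry, so only one minor survives.\<close>

lemma det_4_last_row:
  fixes A :: "'a::comm_ring_1^4^4"
  shows "det A =
    (A$1$1 * A$2$2 * A$3$3 + A$1$2 * A$2$3 * A$3$1 + A$1$3 * A$2$1 * A$3$2
      - A$1$1 * A$2$3 * A$3$2 - A$1$2 * A$2$1 * A$3$3 - A$1$3 * A$2$2 * A$3$1) * A$4$4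
  - (A$1$1 * A$2$2 * A$3$4 + A$1$2 * A$2$4 * A$3$1 + A$1$4 * A$2$1 * A$3$2
      - A$1$1 * A$2$4 * A$3$2 - A$1$2 * A$2$1 * A$3$4 - A$1$4 * A$2$2 * A$3$1) * A$4$3
  + (A$1$1 * A$2$3 * A$3$4 + A$1$3 * A$2$4 * A$3$1 + A$1$4 * A$2$1 * A$3$3
      - A$1$1 * A$2$4 * A$3$3 - A$1$3 * A$2$1 * A$3$4 - A$1$4 * A$2$3 * A$3$1) * A$4$2
  - (A$1$2 * A$2$3 * A$3$4 + A$1$3 * A$2$4 * A$3$2 + A$1$4 * A$2$2 * A$3$3
      - A$1$2 * A$2$4 * A$3$3 - A$1$3 * A$2$2 * A$3$4 - A$1$4 * A$2$3 * A$3$2) * A$4$1"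
proof -
  have f1: "finite {2::4, 3, 4}" "1 \<notin> {2::4, 3, 4}" by auto
  have f2: "finite {3::4, 4}" "2 \<notin> {3::4, 4}" by auto
  have f3: "finite {4::4}" "3 \<notin> {4::4}" by auto
  show ?thesis
    unfolding det_def UNIV_4
    unfolding sum_over_permutations_insert[OF f1]
    unfolding sum_over_permutations_insert[OF f2]
    unfolding sum_over_permutations_insert[OF f3]
    unfolding permutes_sing
    by (simp add: sign_swap_id permutation_swap_id sign_compose sign_id swap_id_eq permutation_compose)
      (simp add: algebra_simps)
qed

text \<open>The second difference over the parallelogram spanned by \<open>s u\<close> and \<open>s v\<close> is computed
  by the mean value theorem in both orders.\<close>

lemma second_derivative_symmetric:
  fixes f :: "'a::euclidean_space \<Rightarrow> real"
  assumes U: "open U" "p \<in> U" and f: "C_k_on 2 f U"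
  shows "frechet_derivative (\<lambda>q. frechet_derivative f (at q) u) (at p) v =
         frechet_derivative (\<lambda>q. frechet_derivative f (at q) v) (at p) u"
proof -
  define D where "D u q = frechet_derivative f (at q) u" for u q
  define DD where "DD u v q = frechet_derivative (D u) (at q) v" for u v q
  have fd: "(f has_derivative (\<lambda>u. D u q)) (at q)" if "q \<in> U" for q
    using f that C_k_on_Suc_has_derivative[of 1 f U q] by (simp add: D_def eval_nat_numeral)
  have C1: "C_k_on (Suc 0) (D u) U" for u
    using f by (simp add: D_def[abs_def] eval_nat_numeral)
  have Dd: "(D u has_derivative (\<lambda>v. DD u v q)) (at q)" if "q \<in> U" for q u
    using C_k_on_Suc_has_derivative[OF C1 that] by (simp add: DD_def)
  have cont: "continuous (at p) (DD u v)" for u v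
    using C1[of u] U by (simp add: DD_def[abs_def] continuous_on_eq_continuous_at)
  obtain r where r: "r > 0" "ball p r \<subseteq> U" using U openE by blast
  have line: "p + a *\<^sub>R u + b *\<^sub>R v \<in> ball p \<rho>"
    if "0 \<le> a" "a \<le> s" "0 \<le> b" "b \<le> s" "s * (norm u + norm v) < \<rho>" for a b s u v \<rho>
  proof -
    have "norm (a *\<^sub>R u + b *\<^sub>R v) \<le> a * norm u + b * norm v"
      using norm_triangle_ineq[of "a *\<^sub>R u" "b *\<^sub>R v"] that by simp
    also have "\<dots> \<le> s * norm u + s * norm v"
      using that by (intro add_mono mult_right_mono) auto
    finally have "norm (a *\<^sub>R u + b *\<^sub>R v) < \<rho>" using that by (simp add: algebra_simps)
    moreover have "p - (p + a *\<^sub>R u + b *\<^sub>R v) = - (a *\<^sub>R u + b *\<^sub>R v)" by simp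
    ultimately show ?thesis by (simp only: mem_ball dist_norm norm_minus_cancel)
  qed
  \<comment> \<open>The mean value theorem is used twice: in \<open>a\<close> for the difference of
    \<open>f\<close> along two parallel sides, then in \<open>b\<close> for \<open>D u\<close>
    between them.\<close>
  have key: "\<exists>q \<in> ball p \<rho>. f (p + s *\<^sub>R u + s *\<^sub>R v) - f (p + s *\<^sub>R u) - f (p + s *\<^sub>R v) + f p
      = s * s * DD u v q"
    if s: "s > 0" "s * (norm u + norm v) < \<rho>" and \<rho>: "\<rho> \<le> r" for s u v \<rho>
  proof -
    have inU: "p + a *\<^sub>R u + b *\<^sub>R v \<in> U" if "0 \<le> a" "a \<le> s" "0 \<le> b" "b \<le> s" for a b
      using line[OF that s(2)] r(2) \<rho> by auto
    have d1: "((\<lambda>a. f (p + a *\<^sub>R u + b *\<^sub>R v)) has_real_derivative D u (p + a *\<^sub>R u + b *\<^sub>R v)) (at a)"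
      if "0 \<le> a" "a \<le> s" "0 \<le> b" "b \<le> s" for a b
    proof -
      have "((\<lambda>a. f (p + a *\<^sub>R u + b *\<^sub>R v)) has_derivative (\<lambda>x. D (x *\<^sub>R u) (p + a *\<^sub>R u + b *\<^sub>R v))) (at a)"
        by (rule has_derivative_compose[of "\<lambda>a. p + a *\<^sub>R u + b *\<^sub>R v" "\<lambda>x. x *\<^sub>R u" _ _ f, OF _ fd[OF inU[OF that]]])
          (auto intro!: derivative_eq_intros)
      moreover have "D (x *\<^sub>R u) (p + a *\<^sub>R u + b *\<^sub>R v) = D u (p + a *\<^sub>R u + b *\<^sub>R v) * x" for x
        using linear_scale[OF has_derivative_linear[OF fd[OF inU[OF that]]]] by simp
      ultimately show ?thesis by (simp add: has_field_derivative_def)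
    qed
    have d2: "((\<lambda>b. D u (p + a *\<^sub>R u + b *\<^sub>R v)) has_real_derivative DD u v (p + a *\<^sub>R u + b *\<^sub>R v)) (at b)"
      if "0 \<le> a" "a \<le> s" "0 \<le> b" "b \<le> s" for a b
    proof -
      have "((\<lambda>b. D u (p + a *\<^sub>R u + b *\<^sub>R v)) has_derivative (\<lambda>x. DD u (x *\<^sub>R v) (p + a *\<^sub>R u + b *\<^sub>R v))) (at b)"
        by (rule has_derivative_compose[of "\<lambda>b. p + a *\<^sub>R u + b *\<^sub>R v" "\<lambda>x. x *\<^sub>R v" _ _ "D u", OF _ Dd[OF inU[OF that]]])
          (auto intro!: derivative_eq_intros)
      moreover have "DD u (x *\<^sub>R v) (p + a *\<^sub>R u + b *\<^sub>R v) = DD u v (p + a *\<^sub>R u + b *\<^sub>R v) * x" for x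
        using linear_scale[OF has_derivative_linear[OF Dd[OF inU[OF that]]]] by simp
      ultimately show ?thesis by (simp add: has_field_derivative_def)
    qed
    have "\<exists>a>0. a < s \<and>
        (f (p + s *\<^sub>R u + s *\<^sub>R v) - f (p + s *\<^sub>R u + 0 *\<^sub>R v)) - (f (p + 0 *\<^sub>R u + s *\<^sub>R v) - f (p + 0 *\<^sub>R u + 0 *\<^sub>R v))
        = (s - 0) * (D u (p + a *\<^sub>R u + s *\<^sub>R v) - D u (p + a *\<^sub>R u + 0 *\<^sub>R v))"
      using s(1) by (intro MVT2 DERIV_diff d1) auto
    then obtain a where a: "0 < a" "a < s" and
      ea: "(f (p + s *\<^sub>R u + s *\<^sub>R v) - f (p + s *\<^sub>R u)) - (f (p + s *\<^sub>R v) - f p)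
        = s * (D u (p + a *\<^sub>R u + s *\<^sub>R v) - D u (p + a *\<^sub>R u + 0 *\<^sub>R v))" by auto
    have "\<exists>b>0. b < s \<and> D u (p + a *\<^sub>R u + s *\<^sub>R v) - D u (p + a *\<^sub>R u + 0 *\<^sub>R v)
        = (s - 0) * DD u v (p + a *\<^sub>R u + b *\<^sub>R v)"
      using s(1) a by (intro MVT2 d2) auto
    then obtain b where b: "0 < b" "b < s" and
      eb: "D u (p + a *\<^sub>R u + s *\<^sub>R v) - D u (p + a *\<^sub>R u + 0 *\<^sub>R v) = s * DD u v (p + a *\<^sub>R u + b *\<^sub>R v)"
      by auto
    have "p + a *\<^sub>R u + b *\<^sub>R v \<in> ball p \<rho>" using a b s by (intro line) auto
    moreover have "f (p + s *\<^sub>R u + s *\<^sub>R v) - f (p + s *\<^sub>R u) - f (p + s *\<^sub>R v) + f p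
        = s * s * DD u v (p + a *\<^sub>R u + b *\<^sub>R v)"
      using ea unfolding eb by (simp add: algebra_simps)
    ultimately show ?thesis by blast
  qed
  have "dist (DD u v p) (DD v u p) < e" if e: "e > 0" for e
  proof -
    obtain d1 where d1: "d1 > 0" "\<And>q. dist q p < d1 \<Longrightarrow> dist (DD u v q) (DD u v p) < e / 2"
      using cont[of u v] e unfolding continuous_at_eps_delta by (meson half_gt_zero)
    obtain d2 where d2: "d2 > 0" "\<And>q. dist q p < d2 \<Longrightarrow> dist (DD v u q) (DD v u p) < e / 2"
      using cont[of v u] e unfolding continuous_at_eps_delta by (meson half_gt_zero)
    define \<rho> where "\<rho> = min r (min d1 d2)"
    have \<rho>: "\<rho> > 0" using r d1 d2 by (simp add: \<rho>_def)
    \<comment> \<open>The summand 1 keeps the denominator positive when \<open>u = v = 0\<close> and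
      makes the bound on \<open>s * (norm u + norm v)\<close> strict.\<close>
    define s where "s = \<rho> / (norm u + norm v + 1)"
    have n: "norm u + norm v + 1 > 0" by (simp add: add_nonneg_pos)
    have s: "s > 0" using \<rho> n by (simp add: s_def)
    have "s * (norm u + norm v) < s * (norm u + norm v + 1)" using s by simp
    then have s2: "s * (norm u + norm v) < \<rho>" using n by (simp add: s_def)
    obtain q1 where q1: "q1 \<in> ball p \<rho>"
      "f (p + s *\<^sub>R u + s *\<^sub>R v) - f (p + s *\<^sub>R u) - f (p + s *\<^sub>R v) + f p = s * s * DD u v q1"
      using key[OF s s2] by (auto simp: \<rho>_def)
    obtain q2 where q2: "q2 \<in> ball p \<rho>"
      "f (p + s *\<^sub>R v + s *\<^sub>R u) - f (p + s *\<^sub>R v) - f (p + s *\<^sub>R u) + f p = s * s * DD v u q2"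
      using key[of s v u \<rho>] s s2 by (auto simp: \<rho>_def add.commute)
    \<comment> \<open>The second difference is symmetric in \<open>u\<close> and \<open>v\<close>,
      so the two mixed derivatives agree at points \<open>q1\<close>, \<open>q2\<close> near
      \<open>p\<close>; continuity brings both back to \<open>p\<close>.\<close>
    have "s * s * DD u v q1 = s * s * DD v u q2"
      using q1(2) q2(2) by (simp add: algebra_simps)
    then have "DD u v q1 = DD v u q2" using s by simp
    moreover have "dist (DD u v q1) (DD u v p) < e / 2" "dist (DD v u q2) (DD v u p) < e / 2"
      using q1(1) q2(1) d1(2)[of q1] d2(2)[of q2] by (simp_all add: \<rho>_def dist_commute[of _ p])
    ultimately show ?thesis unfolding dist_real_def by linarith
  qed
  then have "DD u v p = DD v u p"
    using zero_less_dist_iff less_irrefl by metis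
  then show ?thesis by (simp add: DD_def[abs_def] D_def[abs_def])
qed

text \<open>Smoothness controls derivatives in fixed directions only; the variable direction
  \<open>X q\<close> is expanded in the coordinate axes.\<close>

lemma smooth_on_frechet_derivative_field:
  fixes Y :: "real^'n \<Rightarrow> 'b::real_normed_vector"
  assumes "open U" "smooth_on U X" "smooth_on U Y"
  shows "smooth_on U (\<lambda>q. frechet_derivative Y (at q) (X q))"
proof -
  have "smooth_on U (\<lambda>q. \<Sum>i\<in>UNIV. X q $ i *\<^sub>R frechet_derivative Y (at q) (axis i 1))"
    using assms by (intro smooth_intros smooth_on_frechet_derivative)
  moreover have "(\<Sum>i\<in>UNIV. X q $ i *\<^sub>R frechet_derivative Y (at q) (axis i 1)) =
      frechet_derivative Y (at q) (X q)" if "q \<in> U" for q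
  proof -
    have lin: "linear (frechet_derivative Y (at q))"
      using smooth_on_has_derivative[OF assms(3) that] has_derivative_linear by blast
    have "frechet_derivative Y (at q) (X q) =
        frechet_derivative Y (at q) (\<Sum>i\<in>UNIV. X q $ i *\<^sub>R axis i 1)"
      using basis_expansion[of "X q"] by (simp add: scalar_mult_eq_scaleR)
    then show ?thesis by (simp add: linear_sum[OF lin] linear_scale[OF lin])
  qed
  ultimately show ?thesis by (subst smooth_on_cong[OF assms(1), symmetric]) auto
qed

section \<open>The Levi-Civita connection of \<open>-A t\<^sup>2 dt\<^sup>2 + B t Hess f\<close>\<close>

text \<open>This is the Koszul formula, in which the Lie brackets of constant fields vanish.\<close>

lemma levi_civita_on_unique_const:
  assumes U: "open U" "p \<in> U" and n: "levi_civita_on U g nabla" "levi_civita_on U g nabla'"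
    and sym: "\<And>x y. g p x y = g p y x" and diff: "\<And>x y z. g p (x - y) z = g p x z - g p y z"
    and nondeg: "nondegenerate_form (g p)"
  shows "nabla (\<lambda>_. x) (\<lambda>_. y) p = nabla' (\<lambda>_. x) (\<lambda>_. y) p"
proof -
  define D where "D z x y = frechet_derivative (\<lambda>q. g q x y) (at p) z" for x y z
  have koszul: "D x y z + D y z x - D z x y = 2 * g p (nabla (\<lambda>_. x) (\<lambda>_. y) p) z"
    if "levi_civita_on U g nabla" for nabla x y z
  proof -
    have tors: "nabla (\<lambda>_. x) (\<lambda>_. y) p = nabla (\<lambda>_. y) (\<lambda>_. x) p" for x y
    proof -
      have "nabla (\<lambda>_. x) (\<lambda>_. y) p - nabla (\<lambda>_. y) (\<lambda>_. x) p = lie_bracket (\<lambda>_. x) (\<lambda>_. y) p"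
        using that U by (simp add: levi_civita_on_def smooth_on_const)
      then show ?thesis by (simp add: lie_bracket_def)
    qed
    have met: "D x y z = g p (nabla (\<lambda>_. x) (\<lambda>_. y) p) z + g p y (nabla (\<lambda>_. x) (\<lambda>_. z) p)" for x y z
      unfolding D_def
      by (rule that[unfolded levi_civita_on_def, THEN conjunct2, THEN conjunct2, rule_format])
        (simp_all add: U smooth_on_const)
    show ?thesis
      using tors[of x z] tors[of y z] tors[of x y]
      by (simp add: met sym[of y] sym[of x] sym[of z])
  qed
  have "g p (nabla (\<lambda>_. x) (\<lambda>_. y) p - nabla' (\<lambda>_. x) (\<lambda>_. y) p) z = 0" for z
    using koszul[OF n(1), of x y z] koszul[OF n(2), of x y z] by (simp add: diff)
  then have "nabla (\<lambda>_. x) (\<lambda>_. y) p - nabla' (\<lambda>_. x) (\<lambda>_. y) p = 0"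
    using nondeg unfolding nondegenerate_form_def by blast
  then show ?thesis by simp
qed

text \<open>Coordinates are ordered as \<open>(t, v, w)\<close>; this is the projection to the
  domain of the potential.\<close>

definition base :: "real^3 \<Rightarrow> real^2" where
  "base q = vector [q $ 2, q $ 3]"

lemma bounded_linear_base: "bounded_linear base"
  by (rule linear_conv_bounded_linear[THEN iffD1], rule linearI)
    (simp_all add: base_def vec_eq_iff forall_2)

text \<open>A potential \<open>f\<close> with \<open>f\<^sub>1 = \<partial>\<^sub>1 f\<close>, \<open>f\<^sub>2 = \<partial>\<^sub>2 f\<close>, Hessian matrix \<open>(a, b; b, d)\<close> of determinant 1,
  and third derivatives \<open>c\<^sub>1 = f\<^sub>1\<^sub>1\<^sub>1\<close>, \<open>c\<^sub>2 = f\<^sub>1\<^sub>1\<^sub>2\<close>, \<open>c\<^sub>3 = f\<^sub>1\<^sub>2\<^sub>2\<close>, \<open>c\<^sub>4 = f\<^sub>2\<^sub>2\<^sub>2\<close>;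
  the metric studied is \<open>-A t\<^sup>2 dt\<^sup>2 + B t Hess f\<close>.\<close>

locale warped_hessian =
  fixes N :: "(real^2) set" and f f1 f2 a b d c1 c2 c3 c4 :: "real^2 \<Rightarrow> real" and A B :: real
  assumes open_N: "open N"
    and smooth_f: "smooth_on N f" "smooth_on N f1" "smooth_on N f2" "smooth_on N a" "smooth_on N b"
      "smooth_on N d" "smooth_on N c1" "smooth_on N c2" "smooth_on N c3" "smooth_on N c4"
    and D_f: "x \<in> N \<Longrightarrow> (f has_derivative (\<lambda>h. f1 x * h$1 + f2 x * h$2)) (at x)"
    and D_f1: "x \<in> N \<Longrightarrow> (f1 has_derivative (\<lambda>h. a x * h$1 + b x * h$2)) (at x)"
    and D_f2: "x \<in> N \<Longrightarrow> (f2 has_derivative (\<lambda>h. b x * h$1 + d x * h$2)) (at x)"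
    and D_a: "x \<in> N \<Longrightarrow> (a has_derivative (\<lambda>h. c1 x * h$1 + c2 x * h$2)) (at x)"
    and D_b: "x \<in> N \<Longrightarrow> (b has_derivative (\<lambda>h. c2 x * h$1 + c3 x * h$2)) (at x)"
    and D_d: "x \<in> N \<Longrightarrow> (d has_derivative (\<lambda>h. c3 x * h$1 + c4 x * h$2)) (at x)"
    and a_pos: "x \<in> N \<Longrightarrow> a x > 0"
    and hess_det: "x \<in> N \<Longrightarrow> a x * d x - b x * b x = 1"
    and A_pos: "A > 0" and B_pos: "B > 0"
begin

definition M :: "(real^3) set" where
  "M = {q. q$1 > 0 \<and> base q \<in> N}"

definition hess :: "real^3 \<Rightarrow> real^3 \<Rightarrow> real^3 \<Rightarrow> real" where
  "hess p x y = a (base p) * (x$2 * y$2) + b (base p) * (x$2 * y$3 + x$3 * y$2) + d (base p) * (x$3 * y$3)"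

text \<open>With C the cubic form of third derivatives of \<open>f\<close> and e1, e2 the basis of
  the \<open>(v,w)\<close>-plane, \<open>cubic1\<close> is C(x, y, e1) and \<open>cubic2\<close> is
  C(x, y, e2).\<close>

definition cubic1 :: "real^3 \<Rightarrow> real^3 \<Rightarrow> real^3 \<Rightarrow> real" where
  "cubic1 p x y = c1 (base p) * (x$2 * y$2) + c2 (base p) * (x$2 * y$3 + x$3 * y$2) + c3 (base p) * (x$3 * y$3)"

definition cubic2 :: "real^3 \<Rightarrow> real^3 \<Rightarrow> real^3 \<Rightarrow> real" where
  "cubic2 p x y = c2 (base p) * (x$2 * y$2) + c3 (base p) * (x$2 * y$3 + x$3 * y$2) + c4 (base p) * (x$3 * y$3)"

definition metric :: "real^3 \<Rightarrow> real^3 \<Rightarrow> real^3 \<Rightarrow> real" where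
  "metric p x y = - A * (p$1)^2 * (x$1 * y$1) + B * p$1 * hess p x y"

text \<open>A Hessian metric has lowered Christoffel symbols C / 2. Here the index is raised by the
  inverse Hessian matrix \<open>(d, -b; -b, a)\<close>, which has this form because the determinant
  is 1; the remaining terms come from the warping in \<open>t\<close>.\<close>

definition christoffel :: "real^3 \<Rightarrow> real^3 \<Rightarrow> real^3 \<Rightarrow> real^3" where
  "christoffel p x y = vector
    [x$1 * y$1 / p$1 + B / (2 * A * (p$1)^2) * hess p x y,
     (x$1 * y$2 + x$2 * y$1) / (2 * p$1) + (d (base p) * cubic1 p x y - b (base p) * cubic2 p x y) / 2,
     (x$1 * y$3 + x$3 * y$1) / (2 * p$1) + (a (base p) * cubic2 p x y - b (base p) * cubic1 p x y) / 2]"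

section \<open>The domain and the signature of the metric\<close>

lemma open_M: "open M"
proof -
  have "open ({q. 0 < q$1} \<inter> base -` N)"
    using open_N linear_continuous_on[OF bounded_linear_base]
    by (intro open_Int open_Collect_less continuous_intros continuous_open_vimage)
      (auto simp: continuous_on_eq_continuous_at)
  then show ?thesis by (simp add: M_def vimage_def Collect_conj_eq)
qed

lemma M_D: "p \<in> M \<Longrightarrow> p$1 > 0" "p \<in> M \<Longrightarrow> base p \<in> N"
  by (simp_all add: M_def)

lemma smooth_base:
  assumes "smooth_on N u"
  shows "smooth_on M (\<lambda>q. u (base q))"
  using assms by (intro smooth_on_compose_linear[OF open_M bounded_linear_base]) (auto simp: M_D)

lemma D_base:
  assumes "(u has_derivative (\<lambda>h. v1 * h$1 + v2 * h$2)) (at (base p))"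
  shows "((\<lambda>q. u (base q)) has_derivative (\<lambda>h. v1 * h$2 + v2 * h$3)) (at p)"
  using has_derivative_compose[OF bounded_linear_imp_has_derivative[OF bounded_linear_base] assms]
  by (simp add: base_def)

lemmas D_base_intros = D_base[OF D_f[OF M_D(2)]] D_base[OF D_f1[OF M_D(2)]] D_base[OF D_f2[OF M_D(2)]]
  D_base[OF D_a[OF M_D(2)]] D_base[OF D_b[OF M_D(2)]] D_base[OF D_d[OF M_D(2)]]

lemma D_coord:
  "(Y has_derivative Y') F \<Longrightarrow> ((\<lambda>q. Y q $ i) has_derivative (\<lambda>h. Y' h $ i)) F"
  by (rule bounded_linear.has_derivative[OF bounded_linear_vec_nth])

lemma metric_sym: "metric p x y = metric p y x"
  by (simp add: metric_def hess_def algebra_simps)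

lemma metric_linear:
  "metric p (x + x') y = metric p x y + metric p x' y"
  "metric p (x - x') y = metric p x y - metric p x' y"
  "metric p (r *\<^sub>R x) y = r * metric p x y"
  by (simp_all add: metric_def hess_def algebra_simps)

lemma hess_pos:
  assumes "p \<in> M" "x$2 \<noteq> 0 \<or> x$3 \<noteq> 0"
  shows "hess p x x > 0"
proof -
  \<comment> \<open>Completing the square; the coefficient of the second square is the Hessian
    determinant.\<close>
  have eq: "a (base p) * hess p x x = (a (base p) * x$2 + b (base p) * x$3)^2 + (x$3)^2"
  proof -
    have "a (base p) * hess p x x = (a (base p) * x$2 + b (base p) * x$3)^2
        + (a (base p) * d (base p) - b (base p) * b (base p)) * (x$3)^2"
      by (simp add: hess_def power2_eq_square algebra_simps)
    then show ?thesis using hess_det[OF M_D(2)[OF assms(1)]] by simp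
  qed
  have "a (base p) * hess p x x > 0"
  proof (cases "x$3 = 0")
    case True
    then show ?thesis using assms a_pos[OF M_D(2)[OF assms(1)]] unfolding eq by simp
  next
    case False
    then show ?thesis unfolding eq by (simp add: add_nonneg_pos)
  qed
  then show ?thesis using a_pos[OF M_D(2)[OF assms(1)]] by (simp add: zero_less_mult_iff)
qed

lemma hess_nonneg: "p \<in> M \<Longrightarrow> hess p x x \<ge> 0"
  using hess_pos[of p x] by (cases "x$2 = 0 \<and> x$3 = 0") (auto simp: hess_def)

lemma metric_nondegenerate:
  assumes "p \<in> M"
  shows "nondegenerate_form (metric p)"
proof -
  have "x = 0" if *: "\<And>y. metric p x y = 0" for x
  proof -
    \<comment> \<open>Reflecting the \<open>t\<close>-component turns the form evaluated at
      \<open>x\<close>, \<open>x'\<close> into a sum of two nonnegative terms.\<close>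
    define x' :: "real^3" where "x' = vector [- x$1, x$2, x$3]"
    have "A * (p$1)^2 * (x$1 * x$1) + B * p$1 * hess p x x = 0"
      using *[of x'] by (simp add: metric_def hess_def x'_def)
    moreover have "A * (p$1)^2 * (x$1 * x$1) \<ge> 0" "B * p$1 * hess p x x \<ge> 0"
      using A_pos B_pos M_D[OF assms] hess_nonneg[OF assms] by simp_all
    ultimately have "A * (p$1)^2 * (x$1 * x$1) = 0" "B * p$1 * hess p x x = 0" by linarith+
    then have "x$1 = 0" "hess p x x = 0" using A_pos B_pos M_D[OF assms] by auto
    then show ?thesis using hess_pos[OF assms, of x] by (auto simp: vec_eq_iff forall_3)
  qed
  then show ?thesis by (auto simp: nondegenerate_form_def)
qed

lemma metric_indefinite:
  assumes "p \<in> M"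
  shows "indefinite_form (metric p)"
proof -
  have "metric p (vector [1,0,0]) (vector [1,0,0]) < 0"
    using A_pos M_D[OF assms] by (simp add: metric_def hess_def)
  moreover have "metric p (vector [0,1,0]) (vector [0,1,0]) > 0"
    using B_pos a_pos M_D[OF assms] by (simp add: metric_def hess_def)
  ultimately show ?thesis unfolding indefinite_form_def by blast
qed

text \<open>On a negative definite subspace the coordinate \<open>t\<close> is injective.\<close>

lemma metric_negative_index:
  assumes "p \<in> M"
  shows "negative_index (metric p) = 1"
proof -
  let ?S = "{dim V | V. subspace V \<and> (\<forall>x\<in>V. x \<noteq> 0 \<longrightarrow> metric p x x < 0)}"
  have le: "dim V \<le> 1" if V: "subspace V" "\<forall>x\<in>V. x \<noteq> 0 \<longrightarrow> metric p x x < 0" for V :: "(real^3) set"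
  proof -
    have lin: "linear (\<lambda>x::real^3. x$1)" by (simp add: linear_iff)
    have "x = y" if "x \<in> V" "y \<in> V" "x$1 = y$1" for x y
    proof (rule ccontr)
      assume "x \<noteq> y"
      then have "metric p (x - y) (x - y) < 0" using V that subspace_diff by fastforce
      moreover have "metric p (x - y) (x - y) \<ge> 0"
        using B_pos M_D[OF assms] hess_nonneg[OF assms] that(3) by (simp add: metric_def)
      ultimately show False by simp
    qed
    then have "inj_on (\<lambda>x::real^3. x$1) (span V)" using V(1) by (simp add: inj_on_def span_eq_iff[THEN iffD2])
    then have "dim ((\<lambda>x. x$1) ` V) = dim V" by (rule dim_image_eq[OF lin])
    moreover have "dim ((\<lambda>x. x$1) ` V) \<le> DIM(real)" by (rule dim_subset_UNIV)
    ultimately show ?thesis by simp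
  qed
  have "1 \<in> ?S"
  proof -
    let ?e = "axis 1 1 :: real^3"
    have "metric p x x < 0" if "x \<in> span {?e}" "x \<noteq> 0" for x
      using that A_pos M_D[OF assms]
      by (auto simp: span_singleton metric_def hess_def axis_def zero_less_mult_iff zero_less_power2)
    moreover have "dim (span {?e}) = 1"
      by (simp add: dim_span axis_eq_0_iff)
    ultimately show ?thesis by (smt (verit) mem_Collect_eq subspace_span)
  qed
  moreover have "finite ?S" using le by (intro finite_subset[of ?S "{..1}"]) auto
  ultimately show ?thesis unfolding negative_index_def
    using le by (intro Max_eqI) auto
qed

section \<open>Christoffel symbols and the Levi-Civita connection\<close>

lemma christoffel_linear:
  "christoffel p (x + x') y = christoffel p x y + christoffel p x' y"
  "christoffel p x (y + y') = christoffel p x y + christoffel p x y'"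
  "christoffel p (r *\<^sub>R x) y = r *\<^sub>R christoffel p x y"
  "christoffel p x (r *\<^sub>R y) = r *\<^sub>R christoffel p x y"
  by (simp_all add: vec_eq_iff forall_3 christoffel_def hess_def cubic1_def cubic2_def
      add_divide_distrib diff_divide_distrib algebra_simps)

lemma christoffel_sym: "christoffel p x y = christoffel p y x"
  by (simp add: vec_eq_iff forall_3 christoffel_def hess_def cubic1_def cubic2_def algebra_simps)

text \<open>Lowering the index cancels the inverse Hessian matrix, so the result is free of products
  of \<open>a\<close>, \<open>b\<close>, \<open>d\<close> with the cubic form and can be compared
  with derivatives of the metric.\<close>

lemma metric_christoffel:
  assumes "p \<in> M"
  shows "metric p (christoffel p x y) z = - A * p$1 * (x$1 * y$1 * z$1) - B / 2 * hess p x y * z$1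
    + B / 2 * (x$1 * hess p y z + y$1 * hess p x z)
    + B * p$1 / 2 * (cubic1 p x y * z$2 + cubic2 p x y * z$3)"
proof -
  have nz: "p$1 \<noteq> 0" "A \<noteq> 0" using M_D(1)[OF assms] A_pos by auto
  \<comment> \<open>Twice the purely Hessian part of \<open>christoffel p x y\<close>.\<close>
  let ?u = "vector [0, (d (base p) * cubic1 p x y - b (base p) * cubic2 p x y),
     (a (base p) * cubic2 p x y - b (base p) * cubic1 p x y)] :: real^3"
  have 1: "hess p ?u z = cubic1 p x y * z$2 + cubic2 p x y * z$3"
  proof -
    have "hess p ?u z = (a (base p) * d (base p) - b (base p) * b (base p)) *
        (cubic1 p x y * z$2 + cubic2 p x y * z$3)"
      by (simp add: hess_def algebra_simps)
    then show ?thesis using hess_det[OF M_D(2)[OF assms]] by simp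
  qed
  have 2: "hess p (christoffel p x y) z = x$1 / (2 * p$1) * hess p y z + y$1 / (2 * p$1) * hess p x z
      + hess p ?u z / 2"
    by (simp add: hess_def christoffel_def add_divide_distrib diff_divide_distrib algebra_simps)
  have 3: "christoffel p x y $ 1 = x$1 * y$1 / p$1 + B / (2 * A * (p$1)^2) * hess p x y"
    by (simp add: christoffel_def)
  show ?thesis unfolding metric_def 2 1 3 using nz
    by (simp add: field_simps power2_eq_square)
qed

text \<open>Besides the terms with \<open>Y'\<close> and \<open>Z'\<close>, the product rule
  differentiates \<open>t^2\<close>, \<open>t\<close> and the Hessian entries; the last contribution
  is the cubic form of \<open>x\<close>, \<open>Y p\<close>, \<open>Z p\<close>.\<close>

lemma D_metric:
  assumes p: "p \<in> M" and Y: "(Y has_derivative Y') (at p)" and Z: "(Z has_derivative Z') (at p)"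
  shows "((\<lambda>q. metric q (Y q) (Z q)) has_derivative
    (\<lambda>x. - 2 * A * p$1 * (x$1 * Y p $ 1 * Z p $ 1) + B * x$1 * hess p (Y p) (Z p)
       + B * p$1 * (cubic1 p x (Y p) * Z p $ 2 + cubic2 p x (Y p) * Z p $ 3)
       + metric p (Y' x) (Z p) + metric p (Y p) (Z' x))) (at p)"
  unfolding metric_def hess_def
  by (rule derivative_eq_intros D_coord[OF Y] D_coord[OF Z] D_coord[OF has_derivative_ident]
      D_base_intros p refl)+
    (simp add: fun_eq_iff cubic1_def cubic2_def power2_eq_square algebra_simps)

lemma D_metric_christoffel:
  assumes p: "p \<in> M" and Y: "(Y has_derivative Y') (at p)" and Z: "(Z has_derivative Z') (at p)"
  shows "((\<lambda>q. metric q (Y q) (Z q)) has_derivative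
    (\<lambda>x. metric p (Y' x + christoffel p x (Y p)) (Z p) + metric p (Y p) (Z' x + christoffel p x (Z p)))) (at p)"
proof -
  \<comment> \<open>Metric compatibility on constant vectors: in the symmetrization over
    \<open>y\<close> and \<open>z\<close> the terms \<open>hess p x y * z$1\<close> and
    \<open>hess p x z * y$1\<close> cancel.\<close>
  have "- 2 * A * p$1 * (x$1 * y$1 * z$1) + B * x$1 * hess p y z
       + B * p$1 * (cubic1 p x y * z$2 + cubic2 p x y * z$3)
      = metric p (christoffel p x y) z + metric p (christoffel p x z) y" for x y z
    unfolding metric_christoffel[OF p]
    by (simp add: hess_def cubic1_def cubic2_def algebra_simps)
  then show ?thesis
    using D_metric[OF assms]
    by (simp add: metric_linear metric_sym[of p "Y p"] add.assoc add.left_commute add.commute)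
qed

lemma smooth_christoffel:
  assumes "smooth_on M X" "smooth_on M Y"
  shows "smooth_on M (\<lambda>q. christoffel q (X q) (Y q))"
proof (rule smooth_on_componentwise[OF open_M])
  have nz: "\<And>p. p \<in> M \<Longrightarrow> p$1 \<noteq> 0" "A \<noteq> 0" using M_D(1) A_pos by force+
  have "\<forall>i. smooth_on M (\<lambda>q. christoffel q (X q) (Y q) $ i)"
    unfolding forall_3 christoffel_def vector_3 hess_def cubic1_def cubic2_def
    using nz by (intro conjI smooth_intros open_M assms smooth_base smooth_f) auto
  then show "smooth_on M (\<lambda>q. christoffel q (X q) (Y q) $ i)" for i by blast
qed

definition christoffel_connection :: "(real^3 \<Rightarrow> real^3) \<Rightarrow> (real^3 \<Rightarrow> real^3) \<Rightarrow> real^3 \<Rightarrow> real^3" where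
  "christoffel_connection X Y p = frechet_derivative Y (at p) (X p) + christoffel p (X p) (Y p)"

lemma affine_connection_christoffel: "affine_connection_on M christoffel_connection"
proof -
  have sm: "smooth_on M (christoffel_connection X Y)" if "smooth_on M X" "smooth_on M Y" for X Y
    unfolding christoffel_connection_def[abs_def] using that
    by (intro smooth_on_add open_M smooth_on_frechet_derivative_field smooth_christoffel)
  have lin: "linear (frechet_derivative Y (at p))" if "smooth_on M Y" "p \<in> M" for Y :: "real^3 \<Rightarrow> real^3" and p
    using smooth_on_has_derivative[OF that] has_derivative_linear by blast
  have add: "frechet_derivative (\<lambda>q. Y q + Y' q) (at p) =
      (\<lambda>x. frechet_derivative Y (at p) x + frechet_derivative Y' (at p) x)"
    if "smooth_on M Y" "smooth_on M Y'" "p \<in> M" for Y Y' :: "real^3 \<Rightarrow> real^3" and p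
    using that by (intro frechet_derivative_eqI has_derivative_add smooth_on_has_derivative)
  have scale: "frechet_derivative (\<lambda>q. g q *\<^sub>R Y q) (at p) =
      (\<lambda>x. g p *\<^sub>R frechet_derivative Y (at p) x + frechet_derivative g (at p) x *\<^sub>R Y p)"
    if "smooth_on M g" "smooth_on M Y" "p \<in> M" for g :: "real^3 \<Rightarrow> real" and Y :: "real^3 \<Rightarrow> real^3" and p
    using that by (intro frechet_derivative_eqI has_derivative_scaleR smooth_on_has_derivative)
  show ?thesis unfolding affine_connection_on_def
  proof (intro conjI allI impI ballI)
    show "smooth_on M (christoffel_connection X Y)" if "smooth_on M X" "smooth_on M Y" for X Y
      using sm that .
  qed (simp_all add: christoffel_connection_def christoffel_linear add scale
      linear_add[OF lin] linear_scale[OF lin] scaleR_add_right)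
qed

text \<open>Torsion vanishes by symmetry of \<open>christoffel\<close>, and compatibility is
  \<open>D_metric_christoffel\<close>. A general \<open>g\<close> is allowed because an affine
  metric will be known to equal \<open>metric\<close> on \<open>M\<close> only.\<close>

lemma levi_civita_on_christoffel:
  assumes g: "\<And>p x y. p \<in> M \<Longrightarrow> g p x y = metric p x y"
  shows "levi_civita_on M g christoffel_connection"
  unfolding levi_civita_on_def
proof (intro conjI allI impI ballI)
  show "affine_connection_on M christoffel_connection" by (rule affine_connection_christoffel)
  show "christoffel_connection X Y p - christoffel_connection Y X p = lie_bracket X Y p" for X Y p
    by (simp add: christoffel_connection_def lie_bracket_def christoffel_sym[of p "X p"])
  show "frechet_derivative (\<lambda>q. g q (Y q) (Z q)) (at p) (X p) =
      g p (christoffel_connection X Y p) (Z p) + g p (Y p) (christoffel_connection X Z p)"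
    if "smooth_on M X" "smooth_on M Y" "smooth_on M Z" "p \<in> M" for X Y Z p
  proof -
    have "((\<lambda>q. g q (Y q) (Z q)) has_derivative
        (\<lambda>x. metric p (frechet_derivative Y (at p) x + christoffel p x (Y p)) (Z p)
          + metric p (Y p) (frechet_derivative Z (at p) x + christoffel p x (Z p)))) (at p)"
      using that g by (intro has_derivative_transform_within_open[OF D_metric_christoffel open_M]
          smooth_on_has_derivative) auto
    then show ?thesis using g that by (simp add: frechet_derivative_eqI christoffel_connection_def)
  qed
qed

text \<open>Existence, witnessed by \<open>christoffel_connection\<close>, makes the choice in
  \<open>levi_civita\<close> a Levi-Civita connection; uniqueness on constant fields then gives its
  value.\<close>

lemma levi_civita_const:
  assumes g: "\<And>p x y. p \<in> M \<Longrightarrow> g p x y = metric p x y" and p: "p \<in> M"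
  shows "levi_civita M g (\<lambda>_. x) (\<lambda>_. y) p = christoffel p x y"
proof -
  note lc = levi_civita_on_christoffel[OF g]
  have "levi_civita_on M g (levi_civita M g)"
    unfolding levi_civita_def by (rule someI[of "levi_civita_on M g"]) (rule lc)
  moreover have "nondegenerate_form (g p)" using metric_nondegenerate[OF p] g[OF p]
    by (simp add: nondegenerate_form_def)
  ultimately have "levi_civita M g (\<lambda>_. x) (\<lambda>_. y) p = christoffel_connection (\<lambda>_. x) (\<lambda>_. y) p"
    using p lc metric_sym metric_linear
    by (intro levi_civita_on_unique_const[of M p g]) (auto simp: g open_M)
  then show ?thesis by (simp add: christoffel_connection_def)
qed

end

section \<open>Rotations of order three\<close>

lemma special_isometry_group_simps:
  "carrier (special_isometry_group B) = {L. (\<forall>x y. B (L *v x) (L *v y) = B x y) \<and> det L = 1}"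
  "mult (special_isometry_group B) = (**)" "one (special_isometry_group B) = mat 1"
  by (simp_all add: special_isometry_group_def)

lemma monoid_special_isometry_group: "monoid (special_isometry_group B)"
  by (rule monoidI)
    (auto simp: special_isometry_group_simps matrix_vector_mul_assoc[symmetric] det_mul matrix_mul_assoc)

context warped_hessian
begin

text \<open>\<open>u + s J\<close> on the plane of the last two coordinates, where \<open>J\<close> is the complex structure
  of the Hessian metric, and the identity on \<open>\<partial>\<^sub>t\<close>.\<close>

definition conformal :: "real^3 \<Rightarrow> real \<Rightarrow> real \<Rightarrow> real^3^3" where
  "conformal p u s = vector [vector [1, 0, 0],
     vector [0, u - s * b (base p), - s * d (base p)],
     vector [0, s * a (base p), u + s * b (base p)]]"

text \<open>The matrices multiply like the complex numbers u + i s, because \<open>J^2 = -1\<close>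
  on the plane, which is the determinant condition on the Hessian.\<close>

lemma conformal_mult:
  assumes "p \<in> M"
  shows "conformal p u s ** conformal p u' s' = conformal p (u * u' - s * s') (u * s' + s * u')"
proof -
  have "a (base p) * d (base p) = 1 + b (base p) * b (base p)"
    using hess_det[OF M_D(2)[OF assms]] by simp
  then have "s * s' * (a (base p) * d (base p)) = s * s' + s * s' * (b (base p) * b (base p))"
    by (simp add: algebra_simps)
  then show ?thesis
    by (simp add: vec_eq_iff forall_3 matrix_matrix_mult_def sum_3 conformal_def algebra_simps)
qed

lemma conformal_one: "conformal p 1 0 = mat 1"
  by (simp add: vec_eq_iff forall_3 conformal_def mat_def)

lemma det_conformal:
  assumes "p \<in> M"
  shows "det (conformal p u s) = u * u + s * s"
proof -
  have "a (base p) * d (base p) = 1 + b (base p) * b (base p)"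
    using hess_det[OF M_D(2)[OF assms]] by simp
  then have "s * s * (a (base p) * d (base p)) = s * s + s * s * (b (base p) * b (base p))"
    by (simp add: algebra_simps)
  then show ?thesis by (simp add: det_3 conformal_def algebra_simps)
qed

definition J :: "real^3 \<Rightarrow> real^3 \<Rightarrow> real^3" where
  "J p x = vector [0, - b (base p) * x$2 - d (base p) * x$3, a (base p) * x$2 + b (base p) * x$3]"

lemma conformal_apply:
  "(conformal p u s *v x) $ 1 = x$1"
  "(conformal p u s *v x) $ 2 = u * x$2 + s * J p x $ 2"
  "(conformal p u s *v x) $ 3 = u * x$3 + s * J p x $ 3"
  by (simp_all add: matrix_vector_mult_def sum_3 conformal_def J_def algebra_simps)

lemma hess_J:
  assumes "p \<in> M"
  shows "hess p (J p x) y + hess p x (J p y) = 0" "hess p (J p x) (J p y) = hess p x y"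
proof -
  show "hess p (J p x) y + hess p x (J p y) = 0"
    by (simp add: hess_def J_def algebra_simps)
  have "hess p (J p x) (J p y) = (a (base p) * d (base p) - b (base p) * b (base p)) * hess p x y"
    by (simp add: hess_def J_def algebra_simps)
  then show "hess p (J p x) (J p y) = hess p x y"
    using hess_det[OF M_D(2)[OF assms]] by simp
qed

text \<open>\<open>J\<close> is skew and isometric for the Hessian metric, so the cross terms cancel
  and the factor is the squared modulus of u + i s.\<close>

lemma hess_conformal:
  assumes "p \<in> M"
  shows "hess p (conformal p u s *v x) (conformal p u s *v y) = (u * u + s * s) * hess p x y"
proof -
  have "hess p (conformal p u s *v x) (conformal p u s *v y) = u * u * hess p x y
      + u * s * (hess p (J p x) y + hess p x (J p y)) + s * s * hess p (J p x) (J p y)"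
    by (simp add: hess_def conformal_apply algebra_simps)
  then show ?thesis unfolding hess_J[OF assms] by (simp add: algebra_simps)
qed

text \<open>These are the two coefficients of the derivative of
  \<open>a x * d x - b x * b x\<close>, which is constant on \<open>N\<close>. Since
  \<open>(d, -b; -b, a)\<close> inverts the Hessian matrix, they are the traces of the cubic
  form.\<close>

lemma apolarity:
  assumes "x \<in> N"
  shows "d x * c1 x + a x * c3 x - 2 * b x * c2 x = 0" "d x * c2 x + a x * c4 x - 2 * b x * c3 x = 0"
proof -
  have "((\<lambda>x. a x * d x - b x * b x) has_derivative
      (\<lambda>h. (d x * c1 x + a x * c3 x - 2 * b x * c2 x) * h$1 + (d x * c2 x + a x * c4 x - 2 * b x * c3 x) * h$2)) (at x)"
    by (auto intro!: derivative_eq_intros D_a D_b D_d assms simp: algebra_simps)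
  moreover have "((\<lambda>x. a x * d x - b x * b x) has_derivative (\<lambda>h. 0)) (at x)"
    by (rule has_derivative_transform_within_open[OF has_derivative_const[of 1] open_N assms])
      (simp add: hess_det)
  ultimately have "(\<lambda>h::real^2. (d x * c1 x + a x * c3 x - 2 * b x * c2 x) * h$1
      + (d x * c2 x + a x * c4 x - 2 * b x * c3 x) * h$2) = (\<lambda>h. 0)"
    by (rule has_derivative_unique)
  then have *: "(d x * c1 x + a x * c3 x - 2 * b x * c2 x) * h$1
      + (d x * c2 x + a x * c4 x - 2 * b x * c3 x) * h$2 = 0" for h :: "real^2"
    by metis
  show "d x * c1 x + a x * c3 x - 2 * b x * c2 x = 0" "d x * c2 x + a x * c4 x - 2 * b x * c3 x = 0"
    using *[of "vector [1, 0]"] *[of "vector [0, 1]"] by simp_all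
qed

text \<open>A traceless cubic form in the plane lets \<open>J\<close> move between its slots: C(Jx,
  y, z) = C(x, y, Jz), read off at z = e1 and z = e2. The defect is a combination of the two
  apolarity expressions.\<close>

lemma cubic_J:
  assumes "p \<in> M"
  shows "cubic1 p (J p x) y = a (base p) * cubic2 p x y - b (base p) * cubic1 p x y"
    "cubic2 p (J p x) y = b (base p) * cubic2 p x y - d (base p) * cubic1 p x y"
proof -
  let ?x = "base p"
  have "cubic1 p (J p x) y - (a ?x * cubic2 p x y - b ?x * cubic1 p x y)
      = - (x$3 * y$2) * (d ?x * c1 ?x + a ?x * c3 ?x - 2 * b ?x * c2 ?x)
        - (x$3 * y$3) * (d ?x * c2 ?x + a ?x * c4 ?x - 2 * b ?x * c3 ?x)"
    by (simp add: cubic1_def cubic2_def J_def algebra_simps)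
  then show "cubic1 p (J p x) y = a (base p) * cubic2 p x y - b (base p) * cubic1 p x y"
    by (simp add: apolarity M_D(2)[OF assms])
  have "cubic2 p (J p x) y - (b ?x * cubic2 p x y - d ?x * cubic1 p x y)
      = (x$2 * y$2) * (d ?x * c1 ?x + a ?x * c3 ?x - 2 * b ?x * c2 ?x)
        + (x$2 * y$3) * (d ?x * c2 ?x + a ?x * c4 ?x - 2 * b ?x * c3 ?x)"
    by (simp add: cubic1_def cubic2_def J_def algebra_simps)
  then show "cubic2 p (J p x) y = b (base p) * cubic2 p x y - d (base p) * cubic1 p x y"
    by (simp add: apolarity M_D(2)[OF assms])
qed

lemma cubic_sym: "cubic1 p x y = cubic1 p y x" "cubic2 p x y = cubic2 p y x"
  by (simp_all add: cubic1_def cubic2_def algebra_simps)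

text \<open>Write L = u + s J on the plane and let \<zeta> = u + i s. Moving both copies of L to the
  third slot gives C(Lx, Ly, z) = C(x, y, L^2 z); the hypotheses say that \<zeta>^2 is the conjugate
  of \<zeta>, so L^2 = u - s J.\<close>

lemma cubic_conformal:
  assumes p: "p \<in> M" and u: "u * u - s * s = u" "2 * u * s = - s"
  defines "x' \<equiv> \<lambda>x. conformal p u s *v x"
  shows "cubic1 p (x' x) (x' y) = (u + s * b (base p)) * cubic1 p x y - s * a (base p) * cubic2 p x y"
    "cubic2 p (x' x) (x' y) = s * d (base p) * cubic1 p x y + (u - s * b (base p)) * cubic2 p x y"
proof -
  let ?a = "a (base p)" and ?b = "b (base p)" and ?d = "d (base p)"
  have det: "?a * ?d - ?b * ?b = 1" using hess_det[OF M_D(2)[OF p]] .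
  have 1: "cubic1 p (x' x) (x' y) = u * u * cubic1 p x y
      + u * s * (cubic1 p (J p x) y + cubic1 p (J p y) x) + s * s * cubic1 p (J p x) (J p y)"
    and 2: "cubic2 p (x' x) (x' y) = u * u * cubic2 p x y
      + u * s * (cubic2 p (J p x) y + cubic2 p (J p y) x) + s * s * cubic2 p (J p x) (J p y)"
    by (simp_all add: x'_def cubic1_def cubic2_def conformal_apply algebra_simps)
  have R: "cubic1 p x (J p y) = ?a * cubic2 p x y - ?b * cubic1 p x y"
    "cubic2 p x (J p y) = ?b * cubic2 p x y - ?d * cubic1 p x y"
    using cubic_J[OF p, of y x] by (simp_all only: cubic_sym[of p "J p y" x] cubic_sym[of p y x])
  have "cubic1 p (J p x) (J p y) = - (?a * ?d - ?b * ?b) * cubic1 p x y"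
    "cubic2 p (J p x) (J p y) = - (?a * ?d - ?b * ?b) * cubic2 p x y"
    unfolding cubic_J[OF p, of x "J p y"] R by (simp_all add: algebra_simps)
  then have JJ: "cubic1 p (J p x) (J p y) = - cubic1 p x y" "cubic2 p (J p x) (J p y) = - cubic2 p x y"
    by (simp_all add: det)
  have "cubic1 p (x' x) (x' y) = (u * u - s * s) * cubic1 p x y
      + (2 * u * s) * (?a * cubic2 p x y - ?b * cubic1 p x y)"
    unfolding 1 JJ unfolding cubic_J[OF p] cubic_sym[of p y] by (simp add: algebra_simps)
  then show "cubic1 p (x' x) (x' y) = (u + s * ?b) * cubic1 p x y - s * ?a * cubic2 p x y"
    unfolding u by (simp add: algebra_simps)
  have "cubic2 p (x' x) (x' y) = (u * u - s * s) * cubic2 p x y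
      + (2 * u * s) * (?b * cubic2 p x y - ?d * cubic1 p x y)"
    unfolding 2 JJ unfolding cubic_J[OF p] cubic_sym[of p y] by (simp add: algebra_simps)
  then show "cubic2 p (x' x) (x' y) = s * ?d * cubic1 p x y + (u - s * ?b) * cubic2 p x y"
    unfolding u by (simp add: algebra_simps)
qed

text \<open>The part of a symmetric tensor invariant under all rotations of the plane.\<close>

definition axial :: "real \<Rightarrow> real \<Rightarrow> real \<Rightarrow> real^3 \<Rightarrow> real^3 \<Rightarrow> real^3 \<Rightarrow> real^3" where
  "axial \<alpha> \<beta> \<gamma> p x y = vector [\<alpha> * (x$1 * y$1) + \<gamma> * hess p x y,
     \<beta> * (x$1 * y$2 + x$2 * y$1), \<beta> * (x$1 * y$3 + x$3 * y$1)]"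

text \<open>The Christoffel symbols are axial except for their Hessian part, so subtracting them
  only shifts the three parameters and leaves half the cubic form with raised index.\<close>

lemma axial_minus_christoffel:
  "axial \<alpha> \<beta> \<gamma> p x y - christoffel p x y =
    axial (\<alpha> - 1 / p$1) (\<beta> - 1 / (2 * p$1)) (\<gamma> - B / (2 * A * (p$1)^2)) p x y
    - vector [0, (d (base p) * cubic1 p x y - b (base p) * cubic2 p x y) / 2,
        (a (base p) * cubic2 p x y - b (base p) * cubic1 p x y) / 2]"
  by (simp add: vec_eq_iff forall_3 axial_def christoffel_def algebra_simps add_divide_distrib)

lemma axial_conformal:
  assumes "p \<in> M" "u * u + s * s = 1"
  shows "axial \<alpha> \<beta> \<gamma> p (conformal p u s *v x) (conformal p u s *v y) = conformal p u s *v axial \<alpha> \<beta> \<gamma> p x y"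
  by (simp add: vec_eq_iff forall_3 conformal_apply axial_def hess_conformal[OF assms(1)] assms(2))
    (simp add: J_def algebra_simps)

text \<open>The axial part commutes with every rotation. For the cubic part,
  \<open>cubic_conformal\<close> puts u - s J into the third slot; this is the adjoint of u + s J
  for the Hessian metric, so raising the index turns it into \<open>conformal p u s\<close> acting
  on the value.\<close>

lemma difference_conformal:
  fixes \<alpha> \<beta> \<gamma> :: real
  assumes p: "p \<in> M" and u: "u * u + s * s = 1" "u * u - s * s = u" "2 * u * s = - s"
  defines "K \<equiv> \<lambda>x y. axial \<alpha> \<beta> \<gamma> p x y - christoffel p x y"
  shows "K (conformal p u s *v x) (conformal p u s *v y) = conformal p u s *v K x y"
proof -
  let ?L = "conformal p u s" and ?a = "a (base p)" and ?b = "b (base p)" and ?d = "d (base p)"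
  define S where "S x y = (vector [0, (?d * cubic1 p x y - ?b * cubic2 p x y) / 2,
        (?a * cubic2 p x y - ?b * cubic1 p x y) / 2] :: real^3)" for x y
  have "S (?L *v x) (?L *v y) = ?L *v S x y"
    by (simp add: vec_eq_iff forall_3 conformal_apply S_def J_def cubic_conformal[OF p u(2,3)])
      (simp add: algebra_simps add_divide_distrib diff_divide_distrib)
  then show ?thesis
    unfolding K_def axial_minus_christoffel S_def[symmetric] matrix_vector_mult_diff_distrib
    by (simp add: axial_conformal[OF p u(1)])
qed

section \<open>The cyclic group of rotations of order three\<close>

definition rotation :: "real^3 \<Rightarrow> int \<Rightarrow> real^3^3" where
  "rotation p k = conformal p (cos (2 * pi * of_int k / 3)) (sin (2 * pi * of_int k / 3))"

lemma rotation_mult: "p \<in> M \<Longrightarrow> rotation p k ** rotation p l = rotation p (k + l)"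
  by (simp add: rotation_def conformal_mult cos_add sin_add distrib_left add_divide_distrib algebra_simps)

lemma rotation_0: "rotation p 0 = mat 1"
  by (simp add: rotation_def conformal_one)

lemma rotation_eq_iff:
  assumes "p \<in> M"
  shows "rotation p k = rotation p l \<longleftrightarrow> k mod 3 = l mod 3"
proof -
  \<comment> \<open>The entry \<open>s * a\<close> determines \<open>s\<close> as \<open>a\<close>
    is positive, and then a diagonal entry determines \<open>u\<close>. Equality of rotations thus
    means that the angles differ by a multiple of 2 pi.\<close>
  have "conformal p u s = conformal p u' s' \<longleftrightarrow> s = s' \<and> u = u'" for u s u' s'
    using a_pos[OF M_D(2)[OF assms]] by (auto simp: conformal_def vec_eq_iff forall_3)
  then have "rotation p k = rotation p l \<longleftrightarrow>
      (\<exists>n::int. 2 * pi * of_int k / 3 = 2 * pi * of_int l / 3 + 2 * pi * n)"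
    unfolding rotation_def sin_cos_eq_iff[symmetric] by (simp add: mult.commute)
  also have "\<dots> \<longleftrightarrow> (\<exists>n::int. k = l + 3 * n)"
  proof (intro arg_cong[of _ _ Ex] ext)
    fix n :: int
    have "2 * pi * of_int k / 3 = 2 * pi * of_int l / 3 + 2 * pi * n \<longleftrightarrow>
        2 * pi * of_int k = 2 * pi * of_int (l + 3 * n)" by (simp add: field_simps)
    also have "\<dots> \<longleftrightarrow> k = l + 3 * n" by (simp only: mult_cancel_left of_int_eq_iff) simp
    finally show "(2 * pi * of_int k / 3 = 2 * pi * of_int l / 3 + 2 * pi * n) = (k = l + 3 * n)" .
  qed
  also have "\<dots> \<longleftrightarrow> k mod 3 = l mod 3" by presburger
  finally show ?thesis .
qed

lemma rotation_cube_root: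
  defines "\<theta> \<equiv> \<lambda>k. 2 * pi * of_int k / 3"
  shows "cos (\<theta> k) * cos (\<theta> k) + sin (\<theta> k) * sin (\<theta> k) = 1"
    "cos (\<theta> k) * cos (\<theta> k) - sin (\<theta> k) * sin (\<theta> k) = cos (\<theta> k)"
    "2 * cos (\<theta> k) * sin (\<theta> k) = - sin (\<theta> k)"
proof -
  \<comment> \<open>Modulo full turns the doubled angle is the opposite angle, so the double-angle
    formulas give the square as the conjugate.\<close>
  have 2: "2 * \<theta> k = 2 * pi * of_int k - \<theta> k" by (simp add: \<theta>_def)
  note trig = sin_int_2pin cos_int_2pin
  show "cos (\<theta> k) * cos (\<theta> k) + sin (\<theta> k) * sin (\<theta> k) = 1"
    using sin_cos_squared_add3 by (simp add: add.commute)
  show "cos (\<theta> k) * cos (\<theta> k) - sin (\<theta> k) * sin (\<theta> k) = cos (\<theta> k)"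
    using cos_double[of "\<theta> k"] unfolding 2 cos_diff trig by (simp add: power2_eq_square)
  show "2 * cos (\<theta> k) * sin (\<theta> k) = - sin (\<theta> k)"
    using sin_double[of "\<theta> k"] unfolding 2 sin_diff trig by (simp add: mult_ac)
qed

lemma subgroup_rotations:
  assumes p: "p \<in> M"
  shows "subgroup (range (rotation p)) (special_isometry_group (metric p))"
proof -
  let ?G = "special_isometry_group (metric p)"
  interpret monoid ?G by (rule monoid_special_isometry_group)
  have car: "rotation p k \<in> carrier ?G" for k
    unfolding special_isometry_group_simps rotation_def
    by (simp add: det_conformal[OF p] metric_def conformal_apply hess_conformal[OF p] rotation_cube_root(1))
  \<comment> \<open>Uniqueness of inverses in a monoid suffices, since the opposite rotation is an
    explicit two-sided inverse.\<close>
  have inv: "m_inv ?G (rotation p k) = rotation p (- k)" for k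
    by (rule inv_unique'[OF car car, symmetric])
      (simp_all add: special_isometry_group_simps rotation_mult[OF p] rotation_0)
  show ?thesis
  proof (rule subgroup.intro)
    show "\<one>\<^bsub>?G\<^esub> \<in> range (rotation p)"
      by (simp add: special_isometry_group_simps rotation_0[of p, symmetric])
  qed (use car in \<open>auto simp: inv, auto simp: special_isometry_group_simps rotation_mult[OF p]\<close>)
qed

lemma rotations_iso_Z3:
  assumes p: "p \<in> M"
  shows "(special_isometry_group (metric p))\<lparr>carrier := range (rotation p)\<rparr> \<cong> integer_mod_group 3"
proof -
  let ?G = "(special_isometry_group (metric p))\<lparr>carrier := range (rotation p)\<rparr>"
  \<comment> \<open>The map is built out of \<open>integer_mod_group 3\<close>, whose carrier
    consists of the representatives 0, 1, 2, and is reversed at the end because that side is known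
    to be a group.\<close>
  have "rotation p \<in> iso (integer_mod_group 3) ?G"
  proof (rule isoI)
    show "rotation p \<in> hom (integer_mod_group 3) ?G"
      by (auto simp: hom_def special_isometry_group_simps rotation_mult[OF p] rotation_eq_iff[OF p])
    have "rotation p k \<in> rotation p ` {0..<3}" for k
      by (rule image_eqI[of _ _ "k mod 3"]) (simp_all add: rotation_eq_iff[OF p])
    then show "bij_betw (rotation p) (carrier (integer_mod_group 3)) (carrier ?G)"
      by (auto simp: bij_betw_def inj_on_def carrier_integer_mod_group rotation_eq_iff[OF p])
  qed
  then show ?thesis by (intro group.iso_sym[OF group_integer_mod_group] is_isoI)
qed

end

section \<open>Affine spheres with a warped affine metric\<close>

text \<open>Evaluates the two definite descriptions: a second decomposition with another coefficient
  of \<xi> would make \<xi> tangent, and equal coefficients force equal tangent vectors by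
  injectivity.\<close>

lemma tangential_transversal_part:
  assumes "linear (frechet_derivative \<phi> (at p))" "inj (frechet_derivative \<phi> (at p))"
    "\<xi> p \<notin> range (frechet_derivative \<phi> (at p))" "Z = frechet_derivative \<phi> (at p) u + r *\<^sub>R \<xi> p"
  shows "tangential_part \<phi> \<xi> p Z = u" "transversal_part \<phi> \<xi> p Z = r"
proof -
  let ?D = "frechet_derivative \<phi> (at p)"
  have *: "u' = u \<and> r' = r" if "Z = ?D u' + r' *\<^sub>R \<xi> p" for u' r'
  proof -
    have eq: "(r' - r) *\<^sub>R \<xi> p = ?D (u - u')"
      using that assms(4) by (simp add: linear_diff[OF assms(1)] algebra_simps)
    have "r' = r"
    proof (rule ccontr)
      assume "r' \<noteq> r"
      then have "\<xi> p = (1 / (r' - r)) *\<^sub>R ?D (u - u')" unfolding eq[symmetric] by simp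
      then have "\<xi> p = ?D ((1 / (r' - r)) *\<^sub>R (u - u'))" by (simp only: linear_scale[OF assms(1)])
      then show False using assms(3) by blast
    qed
    then show ?thesis using that assms(2,4) by (auto dest: injD)
  qed
  show "tangential_part \<phi> \<xi> p Z = u" "transversal_part \<phi> \<xi> p Z = r"
    unfolding tangential_part_def transversal_part_def using * assms(4) by (blast intro: the_equality)+
qed

context warped_hessian
begin

text \<open>The Gram matrix is \<open>X ** H ** transpose X\<close> with \<open>H\<close> the matrix
  of the metric, whose determinant reduces to the factor shown because the Hessian has determinant
  1.\<close>

lemma det_gram:
  assumes "p \<in> M"
  shows "det (vector [vector [metric p x x, metric p x y, metric p x z],
      vector [metric p y x, metric p y y, metric p y z],
      vector [metric p z x, metric p z y, metric p z z]] :: real^3^3)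
    = - (A * B^2 * (p$1)^4) * (det (vector [x, y, z] :: real^3^3))^2"
proof -
  let ?X = "vector [x, y, z] :: real^3^3" and ?x = "base p"
  let ?H = "vector [vector [- A * (p$1)^2, 0, 0], vector [0, B * p$1 * a ?x, B * p$1 * b ?x],
      vector [0, B * p$1 * b ?x, B * p$1 * d ?x]] :: real^3^3"
  have "det ?H = - A * (p$1)^2 * (B * p$1)^2 * (a ?x * d ?x - b ?x * b ?x)"
    by (simp add: det_3 power2_eq_square algebra_simps)
  then have "det ?H = - (A * B^2 * (p$1)^4)"
    using hess_det[OF M_D(2)[OF assms]] by (simp add: power_mult_distrib eval_nat_numeral)
  then have "det (?X ** ?H ** transpose ?X) = - (A * B^2 * (p$1)^4) * (det ?X)^2"
    by (simp add: det_mul det_transpose power2_eq_square)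
  moreover have "?X ** ?H ** transpose ?X = vector [vector [metric p x x, metric p x y, metric p x z],
      vector [metric p y x, metric p y y, metric p y z],
      vector [metric p z x, metric p z y, metric p z z]]"
    by (simp add: vec_eq_iff forall_3 matrix_matrix_mult_def transpose_def sum_3 metric_def hess_def
        algebra_simps)
  ultimately show ?thesis by simp
qed

text \<open>Reduces both constructions to explicit checks. \<open>D2\<close> is the Gauss formula on
  constant fields, with an axial induced connection and affine metric \<open>metric\<close>;
  \<open>vol\<close> is the volume condition after \<open>det_gram\<close>; a constant transversal
  field has vanishing shape operator.\<close>

lemma affine_sphere_of_warped_hessian:
  fixes \<phi> :: "real^3 \<Rightarrow> real^4" and D\<phi> :: "real^3 \<Rightarrow> real^3 \<Rightarrow> real^4"
    and \<alpha> \<beta> \<gamma> :: "real^3 \<Rightarrow> real"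
  assumes smooth: "smooth_on M \<phi>"
    and D: "\<And>p. p \<in> M \<Longrightarrow> (\<phi> has_derivative D\<phi> p) (at p)"
    and transv: "\<And>p x r. p \<in> M \<Longrightarrow> D\<phi> p x = r *\<^sub>R v \<Longrightarrow> x = 0 \<and> r = 0"
    and D2: "\<And>p y. p \<in> M \<Longrightarrow> ((\<lambda>q. D\<phi> q y) has_derivative
      (\<lambda>x. D\<phi> p (axial (\<alpha> p) (\<beta> p) (\<gamma> p) p x y) + metric p x y *\<^sub>R v)) (at p)"
    and vol: "\<And>p x y z. p \<in> M \<Longrightarrow> \<bar>det_rows [D\<phi> p x, D\<phi> p y, D\<phi> p z, v]\<bar> =
      sqrt A * B * (p$1)^2 * \<bar>det (vector [x, y, z] :: real^3^3)\<bar>"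
  shows "improper_affine_sphere_on M \<phi> (\<lambda>_. v) \<and>
    (\<forall>p\<in>M. indefinite_form (affine_metric \<phi> (\<lambda>_. v) p) \<and> negative_index (affine_metric \<phi> (\<lambda>_. v) p) = 1) \<and>
    admits_pointwise_Z3_or_SO2_symmetry M \<phi> (\<lambda>_. v)"
proof -
  let ?\<xi> = "\<lambda>_::real^3. v"
  have fd: "frechet_derivative \<phi> (at p) = D\<phi> p" if "p \<in> M" for p
    using D[OF that] by (rule frechet_derivative_eqI)
  have lin: "linear (D\<phi> p)" if "p \<in> M" for p using D[OF that] has_derivative_linear by blast
  have inj: "inj (D\<phi> p)" if "p \<in> M" for p
    using transv[OF that, of _ 0] by (auto simp: linear_injective_0[OF lin[OF that]])
  have notin: "v \<notin> range (D\<phi> p)" if "p \<in> M" for p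
    using transv[OF that, of _ 1] by auto
  have flat: "flat_derivative \<phi> (\<lambda>_. x) (\<lambda>_. y) p =
      D\<phi> p (axial (\<alpha> p) (\<beta> p) (\<gamma> p) p x y) + metric p x y *\<^sub>R v" if p: "p \<in> M" for p x y
  proof -
    have "((\<lambda>q. frechet_derivative \<phi> (at q) y) has_derivative
      (\<lambda>x. D\<phi> p (axial (\<alpha> p) (\<beta> p) (\<gamma> p) p x y) + metric p x y *\<^sub>R v)) (at p)"
      by (rule has_derivative_transform_within_open[OF D2[OF p] open_M p]) (simp add: fd)
    then show ?thesis by (simp add: flat_derivative_def frechet_derivative_eqI)
  qed
  have tp: "tangential_part \<phi> ?\<xi> p (D\<phi> p u + r *\<^sub>R v) = u" "transversal_part \<phi> ?\<xi> p (D\<phi> p u + r *\<^sub>R v) = r"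
    if p: "p \<in> M" for p u r
    using tangential_transversal_part[of \<phi> p ?\<xi> "D\<phi> p u + r *\<^sub>R v" u r] lin[OF p] inj[OF p] notin[OF p]
    by (simp_all add: fd[OF p])
  have am: "affine_metric \<phi> ?\<xi> p = metric p" if "p \<in> M" for p
    by (intro ext) (simp add: affine_metric_def flat tp that)
  have dt: "difference_tensor M \<phi> ?\<xi> p x y = axial (\<alpha> p) (\<beta> p) (\<gamma> p) p x y - christoffel p x y"
    if "p \<in> M" for p x y
    using that by (simp add: difference_tensor_def induced_connection_def flat tp levi_civita_const am)
  have so: "shape_operator \<phi> ?\<xi> p x = 0" if p: "p \<in> M" for p x
    using tp(1)[OF p, of 0 0] by (simp add: shape_operator_def linear_0[OF lin[OF p]])
  have volume: "\<bar>det_rows (map (frechet_derivative \<phi> (at p)) Xs @ [v])\<bar> =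
      sqrt \<bar>det_rows (map (\<lambda>x. vector (map (affine_metric \<phi> ?\<xi> p x) Xs) :: real^3) Xs)\<bar>"
    if p: "p \<in> M" and len: "length Xs = CARD(3)" for p Xs
  proof -
    obtain x y z where Xs: "Xs = [x, y, z]"
      using len by (auto simp: numeral_3_eq_3 length_Suc_conv)
    have "det_rows (map (\<lambda>x. vector (map (affine_metric \<phi> ?\<xi> p x) Xs) :: real^3) Xs)
        = - (A * B^2 * (p$1)^4) * (det (vector [x, y, z] :: real^3^3))^2"
      using det_gram[OF p, of x y z] by (simp add: Xs am[OF p] det_rows_def)
    also have "\<bar>\<dots>\<bar> = A * (B * (p$1)^2 * \<bar>det (vector [x, y, z] :: real^3^3)\<bar>)^2"
      using A_pos by (simp add: abs_mult power_mult_distrib flip: power_mult)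
    also have "sqrt \<dots> = sqrt A * B * (p$1)^2 * \<bar>det (vector [x, y, z] :: real^3^3)\<bar>"
      using B_pos by (simp add: real_sqrt_mult abs_mult)
    finally show ?thesis using vol[OF p, of x y z] by (simp add: Xs fd[OF p])
  qed
  have "affine_normal_on M \<phi> ?\<xi>"
    unfolding affine_normal_on_def immersion_on_def transversal_on_def
  proof (intro conjI ballI allI impI)
    show "range (frechet_derivative ?\<xi> (at p)) \<subseteq> range (frechet_derivative \<phi> (at p))" if "p \<in> M" for p
      using linear_0[OF lin[OF that]] by (auto simp: fd[OF that] intro: range_eqI[of _ _ 0])
  qed (use open_M smooth inj notin volume in \<open>simp_all add: fd am metric_nondegenerate smooth_on_const\<close>)
  then have "improper_affine_sphere_on M \<phi> ?\<xi>"
    by (simp add: improper_affine_sphere_on_def affine_sphere_on_def so)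
  moreover have "admits_pointwise_Z3_or_SO2_symmetry M \<phi> ?\<xi>"
    unfolding admits_pointwise_Z3_or_SO2_symmetry_def
  proof
    fix p assume p: "p \<in> M"
    \<comment> \<open>The order-three rotations work at every point, so the first alternative of the
      symmetry condition is always the one established.\<close>
    have "symmetry_subgroup_at M \<phi> ?\<xi> p (range (rotation p))"
      unfolding symmetry_subgroup_at_def am[OF p]
      using subgroup_rotations[OF p] difference_conformal[OF p rotation_cube_root]
      by (auto simp: dt[OF p] rotation_def)
    then show "\<exists>\<Gamma>. symmetry_subgroup_at M \<phi> ?\<xi> p \<Gamma> \<and>
        (let G = (special_isometry_group (affine_metric \<phi> ?\<xi> p))\<lparr>carrier := \<Gamma>\<rparr>
         in G \<cong> integer_mod_group 3 \<or> topologically_isomorphic G SO2)"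
      using rotations_iso_Z3[OF p] by (auto simp: am[OF p])
  qed
  ultimately show ?thesis using metric_indefinite metric_negative_index by (simp add: am)
qed

text \<open>For any \<kappa> the second derivatives give A = 12 c / \<kappa> and B = 1 / \<kappa>;
  the volume condition \<open>sqrt A * B = \<kappa>\<close> then demands
  \<open>\<kappa>^5 = 12 * c\<close>, that is, \<open>A = \<kappa>^4\<close>.\<close>

lemma cone_affine_sphere:
  fixes \<kappa> c :: real
  defines "\<phi> \<equiv> \<lambda>q. vector [q$1 * q$2, q$1 * q$3, q$1 * f (base q) - c * (q$1)^4, q$1] :: real^4"
  assumes \<kappa>: "\<kappa> > 0" "\<kappa>^5 = 12 * c" and AB: "A = \<kappa>^4" "B = 1 / \<kappa>"
  defines "v \<equiv> vector [0, 0, \<kappa>, 0] :: real^4"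
  shows "improper_affine_sphere_on M \<phi> (\<lambda>_. v) \<and>
    (\<forall>p\<in>M. indefinite_form (affine_metric \<phi> (\<lambda>_. v) p) \<and> negative_index (affine_metric \<phi> (\<lambda>_. v) p) = 1) \<and>
    admits_pointwise_Z3_or_SO2_symmetry M \<phi> (\<lambda>_. v)"
proof -
  define D\<phi> :: "real^3 \<Rightarrow> real^3 \<Rightarrow> real^4" where
    "D\<phi> q y = vector [y$1 * q$2 + q$1 * y$2, y$1 * q$3 + q$1 * y$3,
      y$1 * f (base q) + q$1 * (f1 (base q) * y$2 + f2 (base q) * y$3) - 4 * c * (q$1)^3 * y$1, y$1]" for q y
  show ?thesis
  \<comment> \<open>Only the mixed second derivatives have a tangential part: differentiating in
    \<open>t\<close> and \<open>v\<close> gives the \<open>v\<close>-derivative of \<phi> divided by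
    \<open>t\<close>, and likewise for \<open>w\<close>; hence the value of \<beta>.\<close>
  proof (rule affine_sphere_of_warped_hessian[where D\<phi> = D\<phi>
        and \<alpha> = "\<lambda>_. 0" and \<beta> = "\<lambda>p. 1 / p$1" and \<gamma> = "\<lambda>_. 0"])
    have "\<forall>i. smooth_on M (\<lambda>q. \<phi> q $ i)"
      unfolding forall_4 \<phi>_def vector_4
      by (intro conjI smooth_intros open_M smooth_base smooth_f)
    then show "smooth_on M \<phi>" using smooth_on_componentwise[OF open_M] by blast
  next
    fix p assume p: "p \<in> M"
    have "\<forall>i. ((\<lambda>q. \<phi> q $ i) has_derivative (\<lambda>h. D\<phi> p h $ i)) (at p)"
      unfolding forall_4 \<phi>_def vector_4 D\<phi>_def
      by (intro conjI; (rule derivative_eq_intros D_coord[OF has_derivative_ident] D_base_intros p refl)+)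
        (auto simp: fun_eq_iff eval_nat_numeral algebra_simps)
    then show "(\<phi> has_derivative D\<phi> p) (at p)" by (intro has_derivative_vec_componentwise) auto
  next
    fix p :: "real^3" and x :: "real^3" and r :: real
    assume p: "p \<in> M" and "D\<phi> p x = r *\<^sub>R v"
    then show "x = 0 \<and> r = 0"
      using M_D(1)[OF p] \<kappa>(1) by (auto simp: D\<phi>_def v_def vec_eq_iff forall_3 forall_4)
  next
    fix p y :: "real^3" assume p: "p \<in> M"
    have pos: "p$1 \<noteq> 0" using M_D(1)[OF p] by simp
    have m: "metric p x y * \<kappa> = p$1 * hess p x y - 12 * c * (p$1)^2 * (x$1 * y$1)" for x
      unfolding metric_def unfolding AB \<kappa>(2)[symmetric] using \<kappa>(1)
      by (simp add: eval_nat_numeral algebra_simps)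
    let ?u = "\<lambda>x. axial 0 (1 / p$1) 0 p x y" and ?x = "base p"
    have u: "?u x $ 1 = 0" "p$1 * ?u x $ 2 = x$1 * y$2 + x$2 * y$1" "p$1 * ?u x $ 3 = x$1 * y$3 + x$3 * y$1" for x
      using pos by (simp_all add: axial_def)
    have u3: "p$1 * (f1 ?x * ?u x $ 2 + f2 ?x * ?u x $ 3)
        = f1 ?x * (x$1 * y$2 + x$2 * y$1) + f2 ?x * (x$1 * y$3 + x$3 * y$1)" for x
      unfolding u(2,3)[symmetric] by (simp add: algebra_simps)
    define E where "E x = (vector [y$1 * x$2 + x$1 * y$2, y$1 * x$3 + x$1 * y$3,
      f1 ?x * (x$1 * y$2 + x$2 * y$1) + f2 ?x * (x$1 * y$3 + x$3 * y$1) + p$1 * hess p x y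
        - 12 * c * (p$1)^2 * (x$1 * y$1), 0] :: real^4)" for x :: "real^3"
    have "\<forall>i. ((\<lambda>q. D\<phi> q y $ i) has_derivative (\<lambda>x. E x $ i)) (at p)"
      unfolding forall_4 D\<phi>_def vector_4 E_def
      by (intro conjI; (rule derivative_eq_intros D_coord[OF has_derivative_ident] D_base_intros p refl)+)
        (auto simp: fun_eq_iff hess_def power2_eq_square algebra_simps)
    moreover have "E x = D\<phi> p (?u x) + metric p x y *\<^sub>R v" for x
      by (simp add: vec_eq_iff forall_4 E_def D\<phi>_def v_def u u3 m)
    ultimately have "\<forall>i. ((\<lambda>q. D\<phi> q y $ i) has_derivative
        (\<lambda>x. (D\<phi> p (?u x) + metric p x y *\<^sub>R v) $ i)) (at p)"
      by simp
    then show "((\<lambda>q. D\<phi> q y) has_derivative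
        (\<lambda>x. D\<phi> p (axial 0 (1 / p$1) 0 p x y) + metric p x y *\<^sub>R v)) (at p)"
      by (intro has_derivative_vec_componentwise) auto
  next
    fix p x y z :: "real^3" assume p: "p \<in> M"
    have "det_rows [D\<phi> p x, D\<phi> p y, D\<phi> p z, v] = - \<kappa> * (p$1)^2 * det (vector [x, y, z] :: real^3^3)"
      unfolding det_rows_def det_4_last_row det_3
      by (simp add: D\<phi>_def v_def) (simp add: algebra_simps power2_eq_square)
    moreover have "sqrt A = \<kappa>^2"
      using \<kappa>(1) by (intro real_sqrt_unique) (simp_all add: AB)
    then have "sqrt A * B = \<kappa>" using \<kappa>(1) by (simp add: AB power2_eq_square)
    ultimately show "\<bar>det_rows [D\<phi> p x, D\<phi> p y, D\<phi> p z, v]\<bar> =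
        sqrt A * B * (p$1)^2 * \<bar>det (vector [x, y, z] :: real^3^3)\<bar>"
      using \<kappa>(1) by (simp add: abs_mult)
  qed
qed

text \<open>The negative sign of \<open>v\<close> makes the Hessian part of the metric positive. The
  second derivatives give \<open>A\<close> and \<open>B\<close> for any \<open>r\<close>, and the
  volume condition \<open>sqrt A * B = 3 * c * r^2\<close> becomes
  \<open>9 * c^2 * r^5 = 8\<close>.\<close>

lemma graph_affine_sphere:
  fixes r c :: real
  defines "\<phi> \<equiv> \<lambda>q. vector [q$2, q$3, f (base q) + c * (q$1)^3, (q$1)^4] :: real^4"
  assumes r: "r > 0" "9 * c^2 * r^5 = 8" and c: "c > 0" and AB: "A = 4 / r^2" "B = 4 / (3 * c * r^2)"
  defines "v \<equiv> vector [0, 0, 0, - (r^2)] :: real^4"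
  shows "improper_affine_sphere_on M \<phi> (\<lambda>_. v) \<and>
    (\<forall>p\<in>M. indefinite_form (affine_metric \<phi> (\<lambda>_. v) p) \<and> negative_index (affine_metric \<phi> (\<lambda>_. v) p) = 1) \<and>
    admits_pointwise_Z3_or_SO2_symmetry M \<phi> (\<lambda>_. v)"
proof -
  define D\<phi> :: "real^3 \<Rightarrow> real^3 \<Rightarrow> real^4" where
    "D\<phi> q y = vector [y$2, y$3,
      f1 (base q) * y$2 + f2 (base q) * y$3 + 3 * c * (q$1)^2 * y$1, 4 * (q$1)^3 * y$1]" for q y
  show ?thesis
  \<comment> \<open>The \<open>t\<close>-derivative of \<phi> is (0, 0, 3 c t^2, 4 t^3). Matching
    the third components of the second derivatives, 6 c t in \<open>t\<close> and the Hessian in the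
    plane, yields \<alpha> and \<gamma>; the fourth components leave the metric.\<close>
  proof (rule affine_sphere_of_warped_hessian[where D\<phi> = D\<phi>
        and \<alpha> = "\<lambda>p. 2 / p$1" and \<beta> = "\<lambda>_. 0" and \<gamma> = "\<lambda>p. 1 / (3 * c * (p$1)^2)"])
    have "\<forall>i. smooth_on M (\<lambda>q. \<phi> q $ i)"
      unfolding forall_4 \<phi>_def vector_4
      by (intro conjI smooth_intros open_M smooth_base smooth_f)
    then show "smooth_on M \<phi>" using smooth_on_componentwise[OF open_M] by blast
  next
    fix p assume p: "p \<in> M"
    have "\<forall>i. ((\<lambda>q. \<phi> q $ i) has_derivative (\<lambda>h. D\<phi> p h $ i)) (at p)"
      unfolding forall_4 \<phi>_def vector_4 D\<phi>_def
      by (intro conjI; (rule derivative_eq_intros D_coord[OF has_derivative_ident] D_base_intros p refl)+)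
        (auto simp: fun_eq_iff eval_nat_numeral algebra_simps)
    then show "(\<phi> has_derivative D\<phi> p) (at p)" by (intro has_derivative_vec_componentwise) auto
  next
    fix p :: "real^3" and x :: "real^3" and s :: real
    assume p: "p \<in> M" and "D\<phi> p x = s *\<^sub>R v"
    then show "x = 0 \<and> s = 0"
      using M_D(1)[OF p] r(1) c by (auto simp: D\<phi>_def v_def vec_eq_iff forall_3 forall_4)
  next
    fix p y :: "real^3" assume p: "p \<in> M"
    have pos: "p$1 \<noteq> 0" "c \<noteq> 0" using M_D(1)[OF p] c by auto
    have m: "metric p x y * r^2 = 4 * p$1 / (3 * c) * hess p x y - 4 * (p$1)^2 * (x$1 * y$1)" for x
      unfolding metric_def unfolding AB using r(1) c by (simp add: field_simps)
    let ?u = "\<lambda>x. axial (2 / p$1) 0 (1 / (3 * c * (p$1)^2)) p x y" and ?x = "base p"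
    have u: "?u x $ 2 = 0" "?u x $ 3 = 0" "3 * c * (p$1)^2 * ?u x $ 1 = 6 * c * p$1 * (x$1 * y$1) + hess p x y"
      "4 * (p$1)^3 * ?u x $ 1 = 8 * (p$1)^2 * (x$1 * y$1) + 4 * p$1 / (3 * c) * hess p x y" for x
      using pos by (simp_all add: axial_def field_simps eval_nat_numeral)
    define E where "E x = (vector [0, 0, 6 * c * p$1 * (x$1 * y$1) + hess p x y,
      12 * (p$1)^2 * (x$1 * y$1)] :: real^4)" for x :: "real^3"
    have "\<forall>i. ((\<lambda>q. D\<phi> q y $ i) has_derivative (\<lambda>x. E x $ i)) (at p)"
      unfolding forall_4 D\<phi>_def vector_4 E_def
      by (intro conjI; (rule derivative_eq_intros D_coord[OF has_derivative_ident] D_base_intros p refl)+)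
        (auto simp: fun_eq_iff hess_def power2_eq_square algebra_simps)
    moreover have "E x = D\<phi> p (?u x) + metric p x y *\<^sub>R v" for x
      by (simp add: vec_eq_iff forall_4 E_def D\<phi>_def v_def u m)
    ultimately have "\<forall>i. ((\<lambda>q. D\<phi> q y $ i) has_derivative
        (\<lambda>x. (D\<phi> p (?u x) + metric p x y *\<^sub>R v) $ i)) (at p)"
      by simp
    then show "((\<lambda>q. D\<phi> q y) has_derivative
        (\<lambda>x. D\<phi> p (axial (2 / p$1) 0 (1 / (3 * c * (p$1)^2)) p x y) + metric p x y *\<^sub>R v)) (at p)"
      by (intro has_derivative_vec_componentwise) auto
  next
    fix p x y z :: "real^3" assume p: "p \<in> M"
    have "det_rows [D\<phi> p x, D\<phi> p y, D\<phi> p z, v]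
        = - 3 * c * r^2 * (p$1)^2 * det (vector [x, y, z] :: real^3^3)"
      unfolding det_rows_def det_4_last_row det_3
      by (simp add: D\<phi>_def v_def) (simp add: algebra_simps)
    moreover have "sqrt A * B = 3 * c * r^2"
    proof -
      have "sqrt A = 2 / r" using r(1) by (simp add: AB real_sqrt_divide)
      then have "sqrt A * B = 8 / (3 * c * r^3)" by (simp add: AB eval_nat_numeral)
      also have "\<dots> = 3 * c * r^2"
        unfolding r(2)[symmetric] using r(1) c by (simp add: field_simps eval_nat_numeral)
      finally show ?thesis .
    qed
    ultimately show "\<bar>det_rows [D\<phi> p x, D\<phi> p y, D\<phi> p z, v]\<bar> =
        sqrt A * B * (p$1)^2 * \<bar>det (vector [x, y, z] :: real^3^3)\<bar>"
      using c by (simp add: abs_mult)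
  qed
qed

end

section \<open>The Hessian of a graph immersion\<close>

definition partial :: "2 \<Rightarrow> (real^2 \<Rightarrow> real) \<Rightarrow> real^2 \<Rightarrow> real" where
  "partial i u x = frechet_derivative u (at x) (axis i 1)"

lemma smooth_on_partial: "smooth_on N u \<Longrightarrow> smooth_on N (partial i u)"
  unfolding partial_def[abs_def] by (rule smooth_on_frechet_derivative)

lemma has_derivative_partial:
  assumes "smooth_on N u" "x \<in> N"
  shows "(u has_derivative (\<lambda>h. partial 1 u x * h$1 + partial 2 u x * h$2)) (at x)"
proof -
  have D: "(u has_derivative frechet_derivative u (at x)) (at x)"
    by (rule smooth_on_has_derivative[OF assms])
  then have lin: "linear (frechet_derivative u (at x))" by (rule has_derivative_linear)
  have "frechet_derivative u (at x) h = partial 1 u x * h$1 + partial 2 u x * h$2" for h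
  proof -
    have "h = h$1 *\<^sub>R axis 1 1 + h$2 *\<^sub>R axis 2 1" by (simp add: vec_eq_iff forall_2 axis_def)
    then have "frechet_derivative u (at x) h = frechet_derivative u (at x) (h$1 *\<^sub>R axis 1 1 + h$2 *\<^sub>R axis 2 1)"
      by simp
    then show ?thesis by (simp add: linear_add[OF lin] linear_scale[OF lin] partial_def)
  qed
  then show ?thesis using D by presburger
qed

lemma partial_commute:
  assumes "open N" "smooth_on N u" "x \<in> N"
  shows "partial i (partial j u) x = partial j (partial i u) x"
proof -
  have "C_k_on 2 u N" using assms(2) by (simp add: smooth_on_def)
  from second_derivative_symmetric[OF assms(1,3) this] show ?thesis
    by (simp add: partial_def[abs_def])
qed

text \<open>Identities between partial derivatives hold on \<open>N\<close> only; openness permits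
  differentiating them again.\<close>

lemma partial_cong:
  assumes "open N" "x \<in> N" "smooth_on N u" "\<And>y. y \<in> N \<Longrightarrow> u y = w y"
  shows "partial i u x = partial i w x"
proof -
  have "u differentiable (at x)"
    using smooth_on_has_derivative[OF assms(3,2)] by (auto simp: differentiable_def)
  from frechet_derivative_transform_within_open[OF this assms(1,2,4)]
  show ?thesis by (simp add: partial_def)
qed

lemma has_derivative_graph:
  assumes "smooth_on N f" "x \<in> N"
  shows "((\<lambda>x. vector [x$1, x$2, f x] :: real^3) has_derivative
    (\<lambda>h. vector [h$1, h$2, partial 1 f x * h$1 + partial 2 f x * h$2])) (at x)"
proof -
  have "\<forall>i. ((\<lambda>x. (vector [x$1, x$2, f x] :: real^3) $ i) has_derivative
    (\<lambda>h. (vector [h$1, h$2, partial 1 f x * h$1 + partial 2 f x * h$2] :: real^3) $ i)) (at x)"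
    unfolding forall_3 vector_3
    by (intro conjI has_derivative_partial[OF assms]
        bounded_linear.has_derivative[OF bounded_linear_vec_nth] has_derivative_ident)
  then show ?thesis by (intro has_derivative_vec_componentwise) auto
qed

text \<open>Second derivatives of a graph are vertical, hence multiples of the transversal vector
  with zero tangential part, and the affine metric is the Hessian.\<close>

lemma affine_metric_graph:
  assumes "open N" "smooth_on N f" "p \<in> N"
  defines "\<psi> \<equiv> \<lambda>x. vector [x$1, x$2, f x] :: real^3"
  shows "affine_metric \<psi> (\<lambda>_. vector [0, 0, 1]) p x y =
    partial 1 (partial 1 f) p * (x$1 * y$1) + partial 2 (partial 1 f) p * (x$1 * y$2 + x$2 * y$1)
      + partial 2 (partial 2 f) p * (x$2 * y$2)"
proof -
  let ?D = "\<lambda>(q::real^2) (h::real^2). vector [h$1, h$2, partial 1 f q * h$1 + partial 2 f q * h$2] :: real^3"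
  let ?h = "partial 1 (partial 1 f) p * (x$1 * y$1) + partial 2 (partial 1 f) p * (x$1 * y$2 + x$2 * y$1)
      + partial 2 (partial 2 f) p * (x$2 * y$2)"
  have fd: "frechet_derivative \<psi> (at q) = ?D q" if "q \<in> N" for q
    unfolding \<psi>_def by (rule frechet_derivative_eqI[OF has_derivative_graph[OF assms(2) that]])
  have lin: "linear (?D p)"
    using has_derivative_graph[OF assms(2,3)] by (rule has_derivative_linear)
  have "\<forall>i. ((\<lambda>q. ?D q y $ i) has_derivative
      (\<lambda>x. (vector [0, 0, (partial 1 (partial 1 f) p * x$1 + partial 2 (partial 1 f) p * x$2) * y$1
        + (partial 1 (partial 2 f) p * x$1 + partial 2 (partial 2 f) p * x$2) * y$2] :: real^3) $ i)) (at p)"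
    unfolding forall_3 vector_3
    by (intro conjI has_derivative_const has_derivative_add has_derivative_mult_left
        has_derivative_partial[of N] smooth_on_partial assms)
  then have "((\<lambda>q. ?D q y) has_derivative
      (\<lambda>x. vector [0, 0, (partial 1 (partial 1 f) p * x$1 + partial 2 (partial 1 f) p * x$2) * y$1
        + (partial 1 (partial 2 f) p * x$1 + partial 2 (partial 2 f) p * x$2) * y$2])) (at p)"
    by (intro has_derivative_vec_componentwise) auto
  then have "((\<lambda>q. frechet_derivative \<psi> (at q) y) has_derivative
      (\<lambda>x. vector [0, 0, (partial 1 (partial 1 f) p * x$1 + partial 2 (partial 1 f) p * x$2) * y$1
        + (partial 1 (partial 2 f) p * x$1 + partial 2 (partial 2 f) p * x$2) * y$2])) (at p)"
    by (rule has_derivative_transform_within_open[OF _ assms(1,3)]) (simp add: fd)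
  then have "flat_derivative \<psi> (\<lambda>_. x) (\<lambda>_. y) p =
      vector [0, 0, (partial 1 (partial 1 f) p * x$1 + partial 2 (partial 1 f) p * x$2) * y$1
        + (partial 1 (partial 2 f) p * x$1 + partial 2 (partial 2 f) p * x$2) * y$2]"
    by (simp add: flat_derivative_def frechet_derivative_eqI)
  also have "\<dots> = ?D p 0 + ?h *\<^sub>R vector [0, 0, 1]"
    using partial_commute[OF assms(1-3), of 1 2]
    by (simp add: vec_eq_iff forall_3 algebra_simps)
  finally have "flat_derivative \<psi> (\<lambda>_. x) (\<lambda>_. y) p = frechet_derivative \<psi> (at p) 0 + ?h *\<^sub>R vector [0, 0, 1]"
    by (simp only: fd[OF assms(3)])
  moreover have "inj (?D p)" by (auto simp: inj_on_def vec_eq_iff forall_3 forall_2)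
  moreover have "vector [0, 0, 1] \<notin> range (?D p)" by (auto simp: vec_eq_iff forall_3)
  ultimately show ?thesis
    unfolding affine_metric_def
    using lin by (intro tangential_transversal_part(2)[where u = 0]) (simp_all add: fd[OF assms(3)])
qed

text \<open>On the standard basis the volume condition reads
  \<open>\<bar>det Hess f\<bar> = 1\<close>, and positive definiteness fixes the sign. The other
  locale assumptions follow by smoothness and commuting partial derivatives.\<close>

lemma warped_hessian_of_improper_affine_sphere:
  fixes f :: "real^2 \<Rightarrow> real"
  defines "\<psi> \<equiv> \<lambda>x. vector [x$1, x$2, f x] :: real^3"
  assumes sphere: "improper_affine_sphere_on N \<psi> (\<lambda>_. vector [0, 0, 1])"
    and posdef: "\<forall>x\<in>N. positive_definite_form (affine_metric \<psi> (\<lambda>_. vector [0, 0, 1]) x)"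
    and AB: "A > 0" "B > 0"
  shows "warped_hessian N f (partial 1 f) (partial 2 f) (partial 1 (partial 1 f))
    (partial 2 (partial 1 f)) (partial 2 (partial 2 f)) (partial 1 (partial 1 (partial 1 f)))
    (partial 2 (partial 1 (partial 1 f))) (partial 2 (partial 2 (partial 1 f)))
    (partial 2 (partial 2 (partial 2 f))) A B"
proof -
  let ?\<xi> = "\<lambda>_::real^2. vector [0, 0, 1] :: real^3"
  have an: "affine_normal_on N \<psi> ?\<xi>"
    using sphere by (simp add: improper_affine_sphere_on_def affine_sphere_on_def)
  then have N: "open N" and sm: "smooth_on N \<psi>" by (simp_all add: affine_normal_on_def immersion_on_def)
  have f: "smooth_on N f"
    using smooth_on_component[OF N sm, of 3] by (simp add: \<psi>_def)
  note smooth = smooth_on_partial[OF f] smooth_on_partial[OF smooth_on_partial[OF f]]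
    smooth_on_partial[OF smooth_on_partial[OF smooth_on_partial[OF f]]]
  note metric = affine_metric_graph[OF N f, folded \<psi>_def]
  have pos: "partial 1 (partial 1 f) x > 0"
    and det: "partial 1 (partial 1 f) x * partial 2 (partial 2 f) x
      - partial 2 (partial 1 f) x * partial 2 (partial 1 f) x = 1" if x: "x \<in> N" for x
  proof -
    let ?a = "partial 1 (partial 1 f) x" and ?b = "partial 2 (partial 1 f) x" and ?d = "partial 2 (partial 2 f) x"
    have pd: "h \<noteq> 0 \<Longrightarrow> affine_metric \<psi> ?\<xi> x h h > 0" for h
      using posdef x by (simp add: positive_definite_form_def)
    show a: "?a > 0" using pd[of "axis 1 1"] by (simp add: metric[OF x] axis_eq_0_iff) (simp add: axis_def)
    \<comment> \<open>This vector is Hessian-orthogonal to the first axis, and the form takes the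
      value \<open>?a * (?a * ?d - ?b * ?b)\<close> on it.\<close>
    have "(vector [- ?b, ?a] :: real^2) \<noteq> 0" using a by (simp add: vec_eq_iff forall_2)
    from pd[OF this] have "?a * (?a * ?d - ?b * ?b) > 0" by (simp add: metric[OF x] algebra_simps)
    then have pos: "?a * ?d - ?b * ?b > 0" using a by (simp add: zero_less_mult_iff)
    have fd: "frechet_derivative \<psi> (at x) = (\<lambda>h. vector [h$1, h$2, partial 1 f x * h$1 + partial 2 f x * h$2])"
      unfolding \<psi>_def by (rule frechet_derivative_eqI[OF has_derivative_graph[OF f x]])
    have "\<bar>det_rows (map (frechet_derivative \<psi> (at x)) [axis 1 1, axis 2 1] @ [vector [0, 0, 1]])\<bar> =
        sqrt \<bar>det_rows (map (\<lambda>h. vector (map (affine_metric \<psi> ?\<xi> x h) [axis 1 1, axis 2 1])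
          :: real^2) [axis 1 1, axis 2 1])\<bar>"
      by (rule an[unfolded affine_normal_on_def, THEN conjunct2, THEN conjunct2, THEN conjunct2,
            rule_format, OF x, THEN conjunct2, THEN conjunct2, rule_format]) simp
    then have "1 = sqrt \<bar>?a * ?d - ?b * ?b\<bar>"
      by (simp add: det_rows_def fd det_3 det_2 metric[OF x]) (simp add: axis_def)
    then show "?a * ?d - ?b * ?b = 1" using pos by simp
  qed
  have D: "(u has_derivative (\<lambda>h. v * h$1 + w * h$2)) (at x)"
    if "x \<in> N" "smooth_on N u" "partial 1 u x = v" "partial 2 u x = w" for u v w x
    using has_derivative_partial[OF that(2,1)] that(3,4) by simp
  have c3: "partial 1 (partial 2 (partial 2 f)) x = partial 2 (partial 2 (partial 1 f)) x" if x: "x \<in> N" for x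
  proof -
    have "partial 1 (partial 2 (partial 2 f)) x = partial 2 (partial 1 (partial 2 f)) x"
      by (rule partial_commute[OF N smooth(1) x])
    also have "\<dots> = partial 2 (partial 2 (partial 1 f)) x"
      by (rule partial_cong[OF N x smooth(2) partial_commute[OF N f]])
    finally show ?thesis .
  qed
  show ?thesis
  proof
    fix x assume x: "x \<in> N"
    note D = D[OF x]
    show "(f has_derivative (\<lambda>h. partial 1 f x * h$1 + partial 2 f x * h$2)) (at x)"
      by (rule D[OF f refl refl])
    show "(partial 1 f has_derivative
        (\<lambda>h. partial 1 (partial 1 f) x * h$1 + partial 2 (partial 1 f) x * h$2)) (at x)"
      by (rule D[OF smooth(1) refl refl])
    show "(partial 2 f has_derivative
        (\<lambda>h. partial 2 (partial 1 f) x * h$1 + partial 2 (partial 2 f) x * h$2)) (at x)"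
      by (rule D[OF smooth(1) partial_commute[OF N f x] refl])
    show "(partial 1 (partial 1 f) has_derivative (\<lambda>h. partial 1 (partial 1 (partial 1 f)) x * h$1
        + partial 2 (partial 1 (partial 1 f)) x * h$2)) (at x)"
      by (rule D[OF smooth(2) refl refl])
    show "(partial 2 (partial 1 f) has_derivative (\<lambda>h. partial 2 (partial 1 (partial 1 f)) x * h$1
        + partial 2 (partial 2 (partial 1 f)) x * h$2)) (at x)"
      by (rule D[OF smooth(2) partial_commute[OF N smooth(1) x] refl])
    show "(partial 2 (partial 2 f) has_derivative (\<lambda>h. partial 2 (partial 2 (partial 1 f)) x * h$1
        + partial 2 (partial 2 (partial 2 f)) x * h$2)) (at x)"
      by (rule D[OF smooth(2) c3[OF x] refl])
  qed (fact N f smooth pos det AB)+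
qed

theorem theorem8:
  fixes N :: "(real^2) set" and f :: "real^2 \<Rightarrow> real"
    and \<psi> :: "real^2 \<Rightarrow> real^3" and \<phi> :: "real^3 \<Rightarrow> real^4"
    and M :: "(real^3) set" and c :: real
  assumes psi: "\<psi> = (\<lambda>x. vector [x$1, x$2, f x])"
    and sphere: "improper_affine_sphere_on N \<psi> (\<lambda>_. vector [0, 0, 1])"
    and posdef: "\<forall>x\<in>N. positive_definite_form (affine_metric \<psi> (\<lambda>_. vector [0, 0, 1]) x)"
    and c: "c > 0"
    and M: "M = {q. q$1 > 0 \<and> vector [q$2, q$3] \<in> N}"
    and phi:
      "\<phi> = (\<lambda>q. let t = q$1; v = q$2; w = q$3 in
               vector [t * v, t * w, t * f (vector [v, w]) - c * t^4, t]) \<or>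
       \<phi> = (\<lambda>q. let t = q$1; v = q$2; w = q$3 in
               vector [v, w, f (vector [v, w]) + c * t^3, t^4])"
  shows "\<exists>\<xi>. improper_affine_sphere_on M \<phi> \<xi> \<and>
             (\<forall>p\<in>M. indefinite_form (affine_metric \<phi> \<xi> p) \<and>
                    negative_index (affine_metric \<phi> \<xi> p) = 1) \<and>
             admits_pointwise_Z3_or_SO2_symmetry M \<phi> \<xi>"
  using phi
proof
  \<comment> \<open>The positivity of \<open>A\<close> and \<open>B\<close> stays a premise, as the
    two cases use different constants.\<close>
  note wh = warped_hessian_of_improper_affine_sphere[OF sphere[unfolded psi] posdef[unfolded psi]]
  {
    assume phi: "\<phi> = (\<lambda>q. let t = q$1; v = q$2; w = q$3 in
               vector [t * v, t * w, t * f (vector [v, w]) - c * t^4, t])"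
    define \<kappa> where "\<kappa> = root 5 (12 * c)"
    have \<kappa>: "\<kappa> > 0" "\<kappa>^5 = 12 * c" using c by (simp_all add: \<kappa>_def)
    then have "\<kappa>^4 > 0" "1 / \<kappa> > 0" by simp_all
    from warped_hessian.cone_affine_sphere[OF wh[OF this] \<kappa> refl refl]
    show ?thesis
      unfolding phi Let_def M base_def warped_hessian.M_def[OF wh[OF \<open>\<kappa>^4 > 0\<close> \<open>1 / \<kappa> > 0\<close>]]
      by (intro exI[where x = "\<lambda>_. vector [0, 0, \<kappa>, 0]"])
  }
  {
    assume phi: "\<phi> = (\<lambda>q. let t = q$1; v = q$2; w = q$3 in
               vector [v, w, f (vector [v, w]) + c * t^3, t^4])"
    \<comment> \<open>The positive solution of the volume condition
      \<open>9 * c^2 * r^5 = 8\<close>.\<close>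
    define r where "r = root 5 (8 / (9 * c^2))"
    have "r^5 = 8 / (9 * c^2)" unfolding r_def using c by (intro odd_real_root_pow) simp
    then have r: "r > 0" "9 * c^2 * r^5 = 8" using c by (simp_all add: r_def)
    then have AB: "4 / r^2 > 0" "4 / (3 * c * r^2) > 0" using c by auto
    from warped_hessian.graph_affine_sphere[OF wh[OF this] r c refl refl]
    show ?thesis
      unfolding phi Let_def M base_def warped_hessian.M_def[OF wh[OF AB]]
      by (intro exI[where x = "\<lambda>_. vector [0, 0, 0, - (r^2)]"])
  }
qed

end
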